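(* Let $f:\mathcal F\to\mathcal E$ be an essential geometric morphism between toposes. Then $f$ is locally connected if and only if its essential image $f_!:\mathcal F\to\mathcal E$ is a fibration.
   Context: Topos means Grothendieck topos. A geometric morphism $f:\mathcal F\to\mathcal E$ is essential if $f^*$ has a left adjoint $f_!$ (the essential image). It is locally connected if $f_!$ induces an $\mathcal E$-indexed left adjoint, i.e. the functors $(f_!)_E:\mathcal F/f^*(E)\to\mathcal E/E$ sending $\alpha:F\to f^*(E)$ to its transpose $\alpha^t:f_!(F)\to E$ form an $\mathcal E$-indexed functor: for every arrow $h:E'\to E$ in $\mathcal E$ they commute (up to the canonical isomorphism) with the pullback functors $\mathcal F/f^*(E)\to\mathcal F/f^*(E')$ (along $f^*(h)$) and $\mathcal E/E\to\mathcal E/E'$ (along $h$). Fibration means Street fibration: a functor $p:\mathcal D\to\mathcal C$ such that for every arrow $u:c\to p(d)$ there are a cartesian arrow $\widehat u:d'\to d$ and an isomorphism $\sigma:p(d')\simeq c$ with $p(\widehat u)=u\sigma$. An arrow $v:d'\to d$ is cartesian for $p$ if for all $g:d''\to d$ and $h:p(d'')\to p(d')$ with $p(v)h=p(g)$ there is a unique $h':d''\to d'$ with $p(h')=h$ and $vh'=g$. *)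

theory Defs
  imports "HOL-Library.Equipollence" "HOL-Library.FuncSet" "HOL-Library.Infinite_Set"
begin

section \<open>Categories, functors, natural transformations\<close>

record ('o, 'a) cat =
  Obj :: "'o set"
  Arr :: "'a set"
  Dom :: "'a \<Rightarrow> 'o"
  Cod :: "'a \<Rightarrow> 'o"
  Ident :: "'o \<Rightarrow> 'a"
  Comp :: "'a \<Rightarrow> 'a \<Rightarrow> 'a"  (infixr \<open>\<cdot>\<index>\<close> 70)

definition Hom :: "('o, 'a) cat \<Rightarrow> 'o \<Rightarrow> 'o \<Rightarrow> 'a set" where
  "Hom C a b = {f \<in> Arr C. Dom C f = a \<and> Cod C f = b}"

locale category =
  fixes C :: "('o, 'a) cat" (structure)
  assumes Dom_in_Obj: "f \<in> Arr C \<Longrightarrow> Dom C f \<in> Obj C"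
    and Cod_in_Obj: "f \<in> Arr C \<Longrightarrow> Cod C f \<in> Obj C"
    and Ident_in_Hom: "a \<in> Obj C \<Longrightarrow> Ident C a \<in> Hom C a a"
    and Comp_in_Hom: "\<lbrakk>f \<in> Hom C a b; g \<in> Hom C b c\<rbrakk> \<Longrightarrow> g \<cdot> f \<in> Hom C a c"
    and Comp_Ident: "f \<in> Hom C a b \<Longrightarrow> f \<cdot> Ident C a = f"
    and Ident_Comp: "f \<in> Hom C a b \<Longrightarrow> Ident C b \<cdot> f = f"
    and Comp_assoc: "\<lbrakk>f \<in> Hom C a b; g \<in> Hom C b c; h \<in> Hom C c d\<rbrakk>
      \<Longrightarrow> (h \<cdot> g) \<cdot> f = h \<cdot> (g \<cdot> f)"

definition iso_arr :: "('o, 'a) cat \<Rightarrow> 'a \<Rightarrow> bool" where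
  "iso_arr C f \<longleftrightarrow> f \<in> Arr C \<and>
     (\<exists>g \<in> Hom C (Cod C f) (Dom C f).
        g \<cdot>\<^bsub>C\<^esub> f = Ident C (Dom C f) \<and> f \<cdot>\<^bsub>C\<^esub> g = Ident C (Cod C f))"

record ('o, 'a, 'p, 'b) ftr =
  FObj :: "'o \<Rightarrow> 'p"
  FArr :: "'a \<Rightarrow> 'b"

locale is_functor = C: category C + D: category D
  for C :: "('o, 'a) cat" and D :: "('p, 'b) cat" +
  fixes F :: "('o, 'a, 'p, 'b) ftr"
  assumes FObj_in_Obj: "a \<in> Obj C \<Longrightarrow> FObj F a \<in> Obj D"
    and FArr_in_Hom: "f \<in> Hom C a b \<Longrightarrow> FArr F f \<in> Hom D (FObj F a) (FObj F b)"
    and FArr_Ident: "a \<in> Obj C \<Longrightarrow> FArr F (Ident C a) = Ident D (FObj F a)"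
    and FArr_Comp: "\<lbrakk>f \<in> Hom C a b; g \<in> Hom C b c\<rbrakk>
      \<Longrightarrow> FArr F (g \<cdot>\<^bsub>C\<^esub> f) = FArr F g \<cdot>\<^bsub>D\<^esub> FArr F f"

definition id_ftr :: "('o, 'a, 'o, 'a) ftr" where
  "id_ftr = \<lparr>FObj = \<lambda>a. a, FArr = \<lambda>f. f\<rparr>"

definition comp_ftr ::
  "('p, 'b, 'q, 'c) ftr \<Rightarrow> ('o, 'a, 'p, 'b) ftr \<Rightarrow> ('o, 'a, 'q, 'c) ftr" (infixr \<open>\<circ>\<^sub>F\<close> 70) where
  "G \<circ>\<^sub>F F = \<lparr>FObj = \<lambda>a. FObj G (FObj F a), FArr = \<lambda>f. FArr G (FArr F f)\<rparr>"

definition nat_trans ::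
  "('o, 'a) cat \<Rightarrow> ('p, 'b) cat \<Rightarrow> ('o, 'a, 'p, 'b) ftr \<Rightarrow> ('o, 'a, 'p, 'b) ftr
     \<Rightarrow> ('o \<Rightarrow> 'b) \<Rightarrow> bool" where
  "nat_trans C D F G \<tau> \<longleftrightarrow> is_functor C D F \<and> is_functor C D G \<and>
     (\<forall>a \<in> Obj C. \<tau> a \<in> Hom D (FObj F a) (FObj G a)) \<and>
     (\<forall>f \<in> Arr C. \<tau> (Cod C f) \<cdot>\<^bsub>D\<^esub> FArr F f = FArr G f \<cdot>\<^bsub>D\<^esub> \<tau> (Dom C f))"

definition nat_iso ::
  "('o, 'a) cat \<Rightarrow> ('p, 'b) cat \<Rightarrow> ('o, 'a, 'p, 'b) ftr \<Rightarrow> ('o, 'a, 'p, 'b) ftr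
     \<Rightarrow> ('o \<Rightarrow> 'b) \<Rightarrow> bool" where
  "nat_iso C D F G \<tau> \<longleftrightarrow> nat_trans C D F G \<tau> \<and> (\<forall>a \<in> Obj C. iso_arr D (\<tau> a))"

definition equivalent_cats :: "('o, 'a) cat \<Rightarrow> ('p, 'b) cat \<Rightarrow> bool" where
  "equivalent_cats C D \<longleftrightarrow> (\<exists>F G \<eta> \<epsilon>. is_functor C D F \<and> is_functor D C G \<and>
     nat_iso C C id_ftr (G \<circ>\<^sub>F F) \<eta> \<and> nat_iso D D (F \<circ>\<^sub>F G) id_ftr \<epsilon>)"

text \<open>\<open>adjunction C D L R \<eta> \<epsilon>\<close>: the functor \<open>L : C \<rightarrow> D\<close> is left adjoint to \<open>R : D \<rightarrow> C\<close>,
  with unit \<open>\<eta>\<close> and counit \<open>\<epsilon>\<close>.\<close>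

definition adjunction ::
  "('o, 'a) cat \<Rightarrow> ('p, 'b) cat \<Rightarrow> ('o, 'a, 'p, 'b) ftr \<Rightarrow> ('p, 'b, 'o, 'a) ftr
     \<Rightarrow> ('o \<Rightarrow> 'a) \<Rightarrow> ('p \<Rightarrow> 'b) \<Rightarrow> bool" where
  "adjunction C D L R \<eta> \<epsilon> \<longleftrightarrow> is_functor C D L \<and> is_functor D C R \<and>
     nat_trans C C id_ftr (R \<circ>\<^sub>F L) \<eta> \<and> nat_trans D D (L \<circ>\<^sub>F R) id_ftr \<epsilon> \<and>
     (\<forall>c \<in> Obj C. \<epsilon> (FObj L c) \<cdot>\<^bsub>D\<^esub> FArr L (\<eta> c) = Ident D (FObj L c)) \<and>
     (\<forall>d \<in> Obj D. FArr R (\<epsilon> d) \<cdot>\<^bsub>C\<^esub> \<eta> (FObj R d) = Ident C (FObj R d))"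


section \<open>Finite limits\<close>

definition is_cone ::
  "('j, 'k) cat \<Rightarrow> ('o, 'a) cat \<Rightarrow> ('j, 'k, 'o, 'a) ftr \<Rightarrow> 'o \<Rightarrow> ('j \<Rightarrow> 'a) \<Rightarrow> bool" where
  "is_cone J C X x \<pi> \<longleftrightarrow> x \<in> Obj C \<and> (\<forall>j \<in> Obj J. \<pi> j \<in> Hom C x (FObj X j)) \<and>
     (\<forall>u \<in> Arr J. FArr X u \<cdot>\<^bsub>C\<^esub> \<pi> (Dom J u) = \<pi> (Cod J u))"

definition is_limit ::
  "('j, 'k) cat \<Rightarrow> ('o, 'a) cat \<Rightarrow> ('j, 'k, 'o, 'a) ftr \<Rightarrow> 'o \<Rightarrow> ('j \<Rightarrow> 'a) \<Rightarrow> bool" where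
  "is_limit J C X x \<pi> \<longleftrightarrow> is_cone J C X x \<pi> \<and>
     (\<forall>y \<rho>. is_cone J C X y \<rho> \<longrightarrow> (\<exists>!k. k \<in> Hom C y x \<and> (\<forall>j \<in> Obj J. \<pi> j \<cdot>\<^bsub>C\<^esub> k = \<rho> j)))"

text \<open>Every finite category is isomorphic to one whose objects and arrows are natural numbers,
  so it suffices to let \<open>J\<close> range over these.\<close>

definition preserves_finite_limits ::
  "('o, 'a) cat \<Rightarrow> ('p, 'b) cat \<Rightarrow> ('o, 'a, 'p, 'b) ftr \<Rightarrow> bool" where
  "preserves_finite_limits C D F \<longleftrightarrow>
     (\<forall>(J :: (nat, nat) cat) X x \<pi>.
        category J \<and> finite (Obj J) \<and> finite (Arr J) \<and> is_functor J C X \<and> is_limit J C X x \<pi>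
        \<longrightarrow> is_limit J D (F \<circ>\<^sub>F X) (FObj F x) (\<lambda>j. FArr F (\<pi> j)))"

definition is_pullback :: "('o, 'a) cat \<Rightarrow> 'a \<Rightarrow> 'a \<Rightarrow> 'a \<Rightarrow> 'a \<Rightarrow> bool" where
  "is_pullback C f g p q \<longleftrightarrow>
     f \<in> Arr C \<and> g \<in> Arr C \<and> Cod C f = Cod C g \<and>
     p \<in> Hom C (Dom C p) (Dom C f) \<and> q \<in> Hom C (Dom C p) (Dom C g) \<and> f \<cdot>\<^bsub>C\<^esub> p = g \<cdot>\<^bsub>C\<^esub> q \<and>
     (\<forall>x. \<forall>a \<in> Hom C x (Dom C f). \<forall>b \<in> Hom C x (Dom C g). f \<cdot>\<^bsub>C\<^esub> a = g \<cdot>\<^bsub>C\<^esub> b \<longrightarrow>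
        (\<exists>!k. k \<in> Hom C x (Dom C p) \<and> p \<cdot>\<^bsub>C\<^esub> k = a \<and> q \<cdot>\<^bsub>C\<^esub> k = b))"

text \<open>Chosen pullbacks of a cospan \<open>f\<close>, \<open>g\<close>: the projections to \<open>Dom f\<close> and \<open>Dom g\<close>, and the
  arrow into the chosen pullback induced by \<open>a\<close> and \<open>b\<close>.  The choice matters only up to the
  canonical isomorphism.\<close>

definition pb :: "('o, 'a) cat \<Rightarrow> 'a \<Rightarrow> 'a \<Rightarrow> 'a \<times> 'a" where
  "pb C f g = (SOME (p, q). is_pullback C f g p q)"

definition pb_fst :: "('o, 'a) cat \<Rightarrow> 'a \<Rightarrow> 'a \<Rightarrow> 'a" where
  "pb_fst C f g = fst (pb C f g)"

definition pb_snd :: "('o, 'a) cat \<Rightarrow> 'a \<Rightarrow> 'a \<Rightarrow> 'a" where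
  "pb_snd C f g = snd (pb C f g)"

definition pb_lift :: "('o, 'a) cat \<Rightarrow> 'a \<Rightarrow> 'a \<Rightarrow> 'a \<Rightarrow> 'a \<Rightarrow> 'a" where
  "pb_lift C f g a b = (THE k. k \<in> Hom C (Dom C a) (Dom C (pb_fst C f g)) \<and>
     pb_fst C f g \<cdot>\<^bsub>C\<^esub> k = a \<and> pb_snd C f g \<cdot>\<^bsub>C\<^esub> k = b)"


section \<open>Grothendieck toposes\<close>

text \<open>HOL has no type of all sets, so the Grothendieck universe with respect to which sites are
  small and sheaves take their values is a parameter: a type \<open>'u\<close> whose cardinality is an
  infinite regular strong limit.  The small sets are, up to bijection, the subsets of \<open>'u\<close> of
  smaller cardinality.  As in the original definition of a universe, the countable case (small =
  finite) is not excluded.\<close>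

class universe =
  assumes universe_infinite: "infinite (UNIV :: 'a set)"
    and universe_Pow: "A \<prec> (UNIV :: 'a set) \<Longrightarrow> Pow A \<prec> (UNIV :: 'a set)"
    and universe_Union: "\<lbrakk>I \<prec> (UNIV :: 'a set); \<And>i. i \<in> I \<Longrightarrow> B i \<prec> (UNIV :: 'a set)\<rbrakk>
      \<Longrightarrow> (\<Union>i \<in> (I :: 'a set). B i) \<prec> (UNIV :: 'a set)"

text \<open>The class is inhabited: for \<open>nat\<close> the small sets are the finite ones.\<close>

lemma lesspoll_nat_iff_finite: "(A :: nat set) \<prec> (UNIV :: nat set) \<longleftrightarrow> finite A"
proof
  assume A: "A \<prec> (UNIV :: nat set)"
  show "finite A"
  proof (rule ccontr)
    assume "infinite A"
    then have "bij_betw (enumerate A) UNIV A" by (rule bij_enumerate)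
    then have "(UNIV :: nat set) \<approx> A" by (auto simp: eqpoll_def)
    with A show False by (meson eqpoll_sym lesspoll_def)
  qed
qed (simp add: finite_lesspoll_infinite)

instance nat :: universe
proof
  show "infinite (UNIV :: nat set)" by simp
next
  fix A :: "nat set"
  assume "A \<prec> (UNIV :: nat set)"
  then have "finite (Pow A)" by (simp add: lesspoll_nat_iff_finite)
  then show "Pow A \<prec> (UNIV :: nat set)" by (rule finite_lesspoll_infinite[rotated]) simp
next
  fix I :: "nat set" and B :: "nat \<Rightarrow> nat set"
  show "\<lbrakk>I \<prec> (UNIV :: nat set); \<And>i. i \<in> I \<Longrightarrow> B i \<prec> (UNIV :: nat set)\<rbrakk>
    \<Longrightarrow> (\<Union>i \<in> I. B i) \<prec> (UNIV :: nat set)"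
    by (simp add: lesspoll_nat_iff_finite)
qed

definition small :: "'u::universe set \<Rightarrow> bool" where
  "small A \<longleftrightarrow> A \<prec> (UNIV :: 'u set)"

definition sieve :: "('o, 'a) cat \<Rightarrow> 'o \<Rightarrow> 'a set \<Rightarrow> bool" where
  "sieve C c S \<longleftrightarrow> S \<subseteq> {f \<in> Arr C. Cod C f = c} \<and>
     (\<forall>f \<in> S. \<forall>g \<in> Arr C. Cod C g = Dom C f \<longrightarrow> f \<cdot>\<^bsub>C\<^esub> g \<in> S)"

definition pullback_sieve :: "('o, 'a) cat \<Rightarrow> 'a \<Rightarrow> 'a set \<Rightarrow> 'a set" where
  "pullback_sieve C h S = {g \<in> Arr C. Cod C g = Dom C h \<and> h \<cdot>\<^bsub>C\<^esub> g \<in> S}"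

definition grothendieck_topology :: "('o, 'a) cat \<Rightarrow> ('o \<Rightarrow> 'a set set) \<Rightarrow> bool" where
  "grothendieck_topology C J \<longleftrightarrow>
     (\<forall>c \<in> Obj C. (\<forall>S \<in> J c. sieve C c S) \<and>
        {f \<in> Arr C. Cod C f = c} \<in> J c \<and>
        (\<forall>S \<in> J c. \<forall>h \<in> Arr C. Cod C h = c \<longrightarrow> pullback_sieve C h S \<in> J (Dom C h)) \<and>
        (\<forall>S \<in> J c. \<forall>R. sieve C c R \<and> (\<forall>h \<in> S. pullback_sieve C h R \<in> J (Dom C h)) \<longrightarrow> R \<in> J c))"

record ('o, 'a, 'u) psh =
  Sec :: "'o \<Rightarrow> 'u set"
  Res :: "'a \<Rightarrow> 'u \<Rightarrow> 'u"

definition presheaf :: "('o, 'a) cat \<Rightarrow> ('o, 'a, 'u::universe) psh \<Rightarrow> bool" where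
  "presheaf C P \<longleftrightarrow>
     (\<forall>c \<in> Obj C. small (Sec P c)) \<and>
     (\<forall>f \<in> Arr C. Res P f \<in> Sec P (Cod C f) \<rightarrow> Sec P (Dom C f)) \<and>
     (\<forall>c \<in> Obj C. \<forall>x \<in> Sec P c. Res P (Ident C c) x = x) \<and>
     (\<forall>f \<in> Arr C. \<forall>g \<in> Arr C. Cod C g = Dom C f \<longrightarrow>
        (\<forall>x \<in> Sec P (Cod C f). Res P (f \<cdot>\<^bsub>C\<^esub> g) x = Res P g (Res P f x)))"

definition matching_family ::
  "('o, 'a) cat \<Rightarrow> ('o, 'a, 'u) psh \<Rightarrow> 'a set \<Rightarrow> ('a \<Rightarrow> 'u) \<Rightarrow> bool" where
  "matching_family C P S x \<longleftrightarrow> (\<forall>f \<in> S. x f \<in> Sec P (Dom C f)) \<and>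
     (\<forall>f \<in> S. \<forall>g \<in> Arr C. Cod C g = Dom C f \<longrightarrow> Res P g (x f) = x (f \<cdot>\<^bsub>C\<^esub> g))"

definition sheaf ::
  "('o, 'a) cat \<Rightarrow> ('o \<Rightarrow> 'a set set) \<Rightarrow> ('o, 'a, 'u::universe) psh \<Rightarrow> bool" where
  "sheaf C J P \<longleftrightarrow> presheaf C P \<and>
     (\<forall>c \<in> Obj C. \<forall>S \<in> J c. \<forall>x. matching_family C P S x \<longrightarrow>
        (\<exists>!y. y \<in> Sec P c \<and> (\<forall>f \<in> S. Res P f y = x f)))"

text \<open>Arrows of the category of sheaves are triples (source, natural transformation, target); the
  components are made extensional so that equality of arrows is equality of natural
  transformations.\<close>

definition sheaf_arrows ::
  "('o, 'a) cat \<Rightarrow> ('o \<Rightarrow> 'a set set)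
     \<Rightarrow> (('o, 'a, 'u::universe) psh \<times> ('o \<Rightarrow> 'u \<Rightarrow> 'u) \<times> ('o, 'a, 'u) psh) set" where
  "sheaf_arrows C J = {(P, \<theta>, Q). sheaf C J P \<and> sheaf C J Q \<and>
     \<theta> \<in> (\<Pi>\<^sub>E c \<in> Obj C. Sec P c \<rightarrow>\<^sub>E Sec Q c) \<and>
     (\<forall>f \<in> Arr C. \<forall>x \<in> Sec P (Cod C f). \<theta> (Dom C f) (Res P f x) = Res Q f (\<theta> (Cod C f) x))}"

definition sheaf_cat ::
  "('o, 'a) cat \<Rightarrow> ('o \<Rightarrow> 'a set set)
     \<Rightarrow> (('o, 'a, 'u::universe) psh,
         ('o, 'a, 'u) psh \<times> ('o \<Rightarrow> 'u \<Rightarrow> 'u) \<times> ('o, 'a, 'u) psh) cat" where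
  "sheaf_cat C J =
     \<lparr>Obj = {P. sheaf C J P},
      Arr = sheaf_arrows C J,
      Dom = (\<lambda>(P, \<theta>, Q). P),
      Cod = (\<lambda>(P, \<theta>, Q). Q),
      Ident = (\<lambda>P. (P, \<lambda>c \<in> Obj C. \<lambda>x \<in> Sec P c. x, P)),
      Comp = (\<lambda>(P', \<phi>, R) (P, \<theta>, Q). (P, \<lambda>c \<in> Obj C. compose (Sec P c) (\<phi> c) (\<theta> c), R))\<rparr>"

text \<open>Since every small category is isomorphic to one whose objects and arrows form small subsets
  of \<open>'u\<close>, sites on such categories suffice.\<close>

definition grothendieck_topos :: "'u::universe itself \<Rightarrow> ('o, 'a) cat \<Rightarrow> bool" where
  "grothendieck_topos U E \<longleftrightarrow> category E \<and>
     (\<exists>(C :: ('u, 'u) cat) J. category C \<and> small (Obj C) \<and> small (Arr C) \<and>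
        grothendieck_topology C J \<and>
        equivalent_cats E (sheaf_cat C J :: (('u, 'u, 'u) psh, _) cat))"


section \<open>Geometric morphisms\<close>

text \<open>A geometric morphism from \<open>F\<close> (objects \<open>'p\<close>, arrows \<open>'b\<close>) to \<open>E\<close> (objects \<open>'o\<close>, arrows
  \<open>'a\<close>).\<close>

record ('p, 'b, 'o, 'a) geom_mor =
  direct_image :: "('p, 'b, 'o, 'a) ftr"
  inverse_image :: "('o, 'a, 'p, 'b) ftr"
  geom_unit :: "'o \<Rightarrow> 'a"
  geom_counit :: "'p \<Rightarrow> 'b"

definition geometric_morphism ::
  "('p, 'b) cat \<Rightarrow> ('o, 'a) cat \<Rightarrow> ('p, 'b, 'o, 'a, 'z) geom_mor_scheme \<Rightarrow> bool" where
  "geometric_morphism F E f \<longleftrightarrow>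
     adjunction E F (inverse_image f) (direct_image f) (geom_unit f) (geom_counit f) \<and>
     preserves_finite_limits E F (inverse_image f)"

text \<open>An essential geometric morphism carries a left adjoint of its inverse image; this adds no
  information, since adjoints are unique up to unique isomorphism.\<close>

record ('p, 'b, 'o, 'a) ess_geom_mor = "('p, 'b, 'o, 'a) geom_mor" +
  essential_image :: "('p, 'b, 'o, 'a) ftr"
  ess_unit :: "'p \<Rightarrow> 'b"
  ess_counit :: "'o \<Rightarrow> 'a"

definition essential_geometric_morphism ::
  "('p, 'b) cat \<Rightarrow> ('o, 'a) cat \<Rightarrow> ('p, 'b, 'o, 'a) ess_geom_mor \<Rightarrow> bool" where
  "essential_geometric_morphism F E f \<longleftrightarrow> geometric_morphism F E f \<and>
     adjunction F E (essential_image f) (inverse_image f) (ess_unit f) (ess_counit f)"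


section \<open>Locally connected morphisms\<close>

text \<open>The slice \<open>C/c\<close>: objects are arrows \<open>x\<close> of \<open>C\<close> with codomain \<open>c\<close>, arrows are commutative
  triangles \<open>(x, g, y)\<close>, with \<open>g\<close> from the domain of \<open>x\<close> to that of \<open>y\<close>.\<close>

definition slice :: "('o, 'a) cat \<Rightarrow> 'o \<Rightarrow> ('a, 'a \<times> 'a \<times> 'a) cat" where
  "slice C c =
     \<lparr>Obj = {x \<in> Arr C. Cod C x = c},
      Arr = {(x, g, y). x \<in> Arr C \<and> Cod C x = c \<and> y \<in> Arr C \<and> Cod C y = c \<and>
               g \<in> Hom C (Dom C x) (Dom C y) \<and> y \<cdot>\<^bsub>C\<^esub> g = x},
      Dom = (\<lambda>(x, g, y). x),
      Cod = (\<lambda>(x, g, y). y),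
      Ident = (\<lambda>x. (x, Ident C (Dom C x), x)),
      Comp = (\<lambda>(y', h, z) (x, g, y). (x, h \<cdot>\<^bsub>C\<^esub> g, z))\<rparr>"

text \<open>The pullback functor \<open>C/Cod h \<rightarrow> C/Dom h\<close> along \<open>h\<close>.\<close>

definition pullback_ftr :: "('o, 'a) cat \<Rightarrow> 'a \<Rightarrow> ('a, 'a \<times> 'a \<times> 'a, 'a, 'a \<times> 'a \<times> 'a) ftr" where
  "pullback_ftr C h =
     \<lparr>FObj = (\<lambda>x. pb_snd C x h),
      FArr = (\<lambda>(x, g, y). (pb_snd C x h,
                pb_lift C y h (g \<cdot>\<^bsub>C\<^esub> pb_fst C x h) (pb_snd C x h),
                pb_snd C y h))\<rparr>"

definition transp ::
  "('o, 'a) cat \<Rightarrow> ('p, 'b, 'o, 'a) ess_geom_mor \<Rightarrow> 'o \<Rightarrow> 'b \<Rightarrow> 'a" where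
  "transp E f e \<alpha> = ess_counit f e \<cdot>\<^bsub>E\<^esub> FArr (essential_image f) \<alpha>"

text \<open>The functor \<open>(f\<^sub>!)\<^sub>e : F/f\<^sup>*(e) \<rightarrow> E/e\<close>.\<close>

definition ess_slice ::
  "('o, 'a) cat \<Rightarrow> ('p, 'b, 'o, 'a) ess_geom_mor \<Rightarrow> 'o
     \<Rightarrow> ('b, 'b \<times> 'b \<times> 'b, 'a, 'a \<times> 'a \<times> 'a) ftr" where
  "ess_slice E f e =
     \<lparr>FObj = transp E f e,
      FArr = (\<lambda>(\<alpha>, g, \<beta>). (transp E f e \<alpha>, FArr (essential_image f) g, transp E f e \<beta>))\<rparr>"

text \<open>For \<open>h : e' \<rightarrow> e\<close> in \<open>E\<close> and \<open>\<alpha> : a \<rightarrow> f\<^sup>*(e)\<close> in \<open>F\<close>, the component at \<open>\<alpha>\<close> of the canonical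
  comparison from \<open>(f\<^sub>!)\<^sub>e\<^sub>' \<circ> (f\<^sup>* h)\<^sup>*\<close> to \<open>h\<^sup>* \<circ> (f\<^sub>!)\<^sub>e\<close>: with \<open>p\<close>, \<open>q\<close> the projections of
  the pullback of \<open>\<alpha>\<close> along \<open>f\<^sup>*(h)\<close>, it is induced by \<open>f\<^sub>!(p)\<close> and the transpose of \<open>q\<close>.\<close>

definition comparison ::
  "('p, 'b) cat \<Rightarrow> ('o, 'a) cat \<Rightarrow> ('p, 'b, 'o, 'a) ess_geom_mor \<Rightarrow> 'a
     \<Rightarrow> 'b \<Rightarrow> 'a \<times> 'a \<times> 'a" where
  "comparison F E f h \<alpha> =
     (let p = pb_fst F \<alpha> (FArr (inverse_image f) h);
          q = pb_snd F \<alpha> (FArr (inverse_image f) h);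
          q\<^sub>t = transp E f (Dom E h) q;
          \<alpha>\<^sub>t = transp E f (Cod E h) \<alpha>
      in (q\<^sub>t, pb_lift E \<alpha>\<^sub>t h (FArr (essential_image f) p) q\<^sub>t, pb_snd E \<alpha>\<^sub>t h))"

definition locally_connected ::
  "('p, 'b) cat \<Rightarrow> ('o, 'a) cat \<Rightarrow> ('p, 'b, 'o, 'a) ess_geom_mor \<Rightarrow> bool" where
  "locally_connected F E f \<longleftrightarrow>
     (\<forall>h \<in> Arr E.
        nat_iso (slice F (FObj (inverse_image f) (Cod E h))) (slice E (Dom E h))
          (ess_slice E f (Dom E h) \<circ>\<^sub>F pullback_ftr F (FArr (inverse_image f) h))
          (pullback_ftr E h \<circ>\<^sub>F ess_slice E f (Cod E h))
          (comparison F E f h))"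


section \<open>Street fibrations\<close>

definition cartesian ::
  "('p, 'b) cat \<Rightarrow> ('o, 'a) cat \<Rightarrow> ('p, 'b, 'o, 'a) ftr \<Rightarrow> 'b \<Rightarrow> bool" where
  "cartesian D C p v \<longleftrightarrow> v \<in> Arr D \<and>
     (\<forall>g \<in> Arr D. \<forall>h \<in> Hom C (FObj p (Dom D g)) (FObj p (Dom D v)).
        Cod D g = Cod D v \<and> FArr p v \<cdot>\<^bsub>C\<^esub> h = FArr p g \<longrightarrow>
        (\<exists>!h'. h' \<in> Hom D (Dom D g) (Dom D v) \<and> FArr p h' = h \<and> v \<cdot>\<^bsub>D\<^esub> h' = g))"

definition street_fibration ::
  "('p, 'b) cat \<Rightarrow> ('o, 'a) cat \<Rightarrow> ('p, 'b, 'o, 'a) ftr \<Rightarrow> bool" where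
  "street_fibration D C p \<longleftrightarrow> is_functor D C p \<and>
     (\<forall>d \<in> Obj D. \<forall>u \<in> Arr C. Cod C u = FObj p d \<longrightarrow>
        (\<exists>v \<sigma>. cartesian D C p v \<and> Cod D v = d \<and>
           \<sigma> \<in> Hom C (FObj p (Dom D v)) (Dom C u) \<and> iso_arr C \<sigma> \<and>
           FArr p v = u \<cdot>\<^bsub>C\<^esub> \<sigma>))"

end

theory Submission
  imports Defs
begin

text \<open>
  Write \<open>f\<^sub>!\<close> for the essential image, left adjoint to \<open>f\<^sup>*\<close>.  Fix \<open>h : e' \<rightarrow> e\<close> in \<open>E\<close> and
  \<open>\<alpha> : a \<rightarrow> f\<^sup>*(e)\<close> in \<open>F\<close>.  A pullback of \<open>\<alpha>\<close> along \<open>f\<^sup>*(h)\<close>, with projections \<open>p\<close> and \<open>q\<close>, is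
  transposed into a commutative square in \<open>E\<close> with sides \<open>f\<^sub>!(p)\<close>, the transpose of \<open>q\<close>, the transpose
  of \<open>\<alpha>\<close>, and \<open>h\<close>.  The comparison between the two composites in the definition of local
  connectedness is, at \<open>\<alpha>\<close>, the arrow from this square to the pullback in \<open>E\<close>.  So \<open>f\<close> is locally
  connected if and only if transposition takes pullback squares of this kind to pullback squares
  (\<open>locally_connected_iff_transposes_pullbacks\<close>).

  This condition is equivalent to \<open>f\<^sub>!\<close> being a fibration.  Given the condition, an arrow
  \<open>u : c \<rightarrow> f\<^sub>!(d)\<close> is lifted by pulling the unit \<open>d \<rightarrow> f\<^sup>*(f\<^sub>!(d))\<close> back along \<open>f\<^sup>*(u)\<close>: the unit is
  transposed to an identity, so the transposed square exhibits \<open>f\<^sub>!\<close> of the projection to \<open>d\<close> as \<open>u\<close>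
  up to an isomorphism, and the projection is cartesian by the universal property of the pullback
  (\<open>fibration_if_transposes_pullbacks\<close>).  Conversely, if \<open>f\<^sub>!\<close> is a fibration, the pullback in \<open>E\<close>
  can be lifted: a cartesian arrow over its projection to \<open>f\<^sub>!(a)\<close> is the projection to \<open>a\<close> of a
  pullback of \<open>\<alpha>\<close> along \<open>f\<^sup>*(h)\<close>, whose transpose is, up to an isomorphism, the given pullback in
  \<open>E\<close>   (\<open>transposes_pullbacks_if_fibration\<close>).

  All this takes place in categories with pullbacks.  A topos has them because they are computed
  pointwise for sheaves (\<open>sheaf_cat_has_pullbacks\<close>) and pass along equivalences of categories
  (\<open>has_pullbacks_equivalent\<close>).
\<close>

section \<open>Isomorphisms and pullbacks\<close>

context category
begin

text \<open>The laws of a category are restated with typing conditions in terms of \<open>Arr\<close>, \<open>Dom\<close> and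
  \<open>Cod\<close>: the simplifier can discharge these without guessing objects, as rules about \<open>Hom\<close>
  would require.\<close>

lemma Arr_Comp [simp, intro]: "\<lbrakk>f \<in> Arr C; g \<in> Arr C; Dom C g = Cod C f\<rbrakk> \<Longrightarrow> g \<cdot> f \<in> Arr C"
  using Comp_in_Hom[of f _ _ g] by (auto simp: Hom_def)

lemma Dom_Comp [simp]: "\<lbrakk>f \<in> Arr C; g \<in> Arr C; Dom C g = Cod C f\<rbrakk> \<Longrightarrow> Dom C (g \<cdot> f) = Dom C f"
  using Comp_in_Hom[of f _ _ g] by (auto simp: Hom_def)

lemma Cod_Comp [simp]: "\<lbrakk>f \<in> Arr C; g \<in> Arr C; Dom C g = Cod C f\<rbrakk> \<Longrightarrow> Cod C (g \<cdot> f) = Cod C g"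
  using Comp_in_Hom[of f _ _ g] by (auto simp: Hom_def)

lemma Arr_Ident [simp]: "a \<in> Obj C \<Longrightarrow> Ident C a \<in> Arr C"
  and Dom_Ident [simp]: "a \<in> Obj C \<Longrightarrow> Dom C (Ident C a) = a"
  and Cod_Ident [simp]: "a \<in> Obj C \<Longrightarrow> Cod C (Ident C a) = a"
  using Ident_in_Hom by (auto simp: Hom_def)

lemma Comp_Ident' [simp]: "\<lbrakk>f \<in> Arr C; a = Dom C f\<rbrakk> \<Longrightarrow> f \<cdot> Ident C a = f"
  using Comp_Ident by (auto simp: Hom_def)

lemma Ident_Comp' [simp]: "\<lbrakk>f \<in> Arr C; b = Cod C f\<rbrakk> \<Longrightarrow> Ident C b \<cdot> f = f"
  using Ident_Comp by (auto simp: Hom_def)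

lemma assoc:
  "\<lbrakk>f \<in> Arr C; g \<in> Arr C; h \<in> Arr C; Dom C g = Cod C f; Dom C h = Cod C g\<rbrakk>
    \<Longrightarrow> (h \<cdot> g) \<cdot> f = h \<cdot> (g \<cdot> f)"
  using Comp_assoc[of f "Dom C f" "Cod C f" g "Cod C g" h "Cod C h"] by (auto simp: Hom_def)

lemma isoE:
  assumes "iso_arr C f"
  obtains g where "g \<in> Arr C" "Dom C g = Cod C f" "Cod C g = Dom C f"
    "g \<cdot> f = Ident C (Dom C f)" "f \<cdot> g = Ident C (Cod C f)"
  using assms by (auto simp: iso_arr_def Hom_def)

lemma isoI:
  assumes "f \<in> Arr C" "g \<in> Arr C" "Dom C g = Cod C f" "Cod C g = Dom C f"
    "g \<cdot> f = Ident C (Dom C f)" "f \<cdot> g = Ident C (Cod C f)"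
  shows "iso_arr C f"
  using assms by (auto simp: iso_arr_def Hom_def)

lemma iso_in_Arr: "iso_arr C f \<Longrightarrow> f \<in> Arr C"
  by (simp add: iso_arr_def)

lemma iso_Comp:
  assumes f: "iso_arr C f" and g: "iso_arr C g" and fg: "Dom C g = Cod C f"
  shows "iso_arr C (g \<cdot> f)"
proof -
  note [simp] = iso_in_Arr[OF f] iso_in_Arr[OF g] fg Dom_in_Obj Cod_in_Obj
  obtain f' where [simp]: "f' \<in> Arr C" "Dom C f' = Cod C f" "Cod C f' = Dom C f"
    and f': "f' \<cdot> f = Ident C (Dom C f)" "f \<cdot> f' = Ident C (Cod C f)" using isoE[OF f] by metis
  obtain g' where [simp]: "g' \<in> Arr C" "Dom C g' = Cod C g" "Cod C g' = Cod C f"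
    and g': "g' \<cdot> g = Ident C (Cod C f)" "g \<cdot> g' = Ident C (Cod C g)" using isoE[OF g] fg by metis
  have "(f' \<cdot> g') \<cdot> (g \<cdot> f) = f' \<cdot> ((g' \<cdot> g) \<cdot> f)" by (simp add: assoc)
  moreover have "(g \<cdot> f) \<cdot> (f' \<cdot> g') = g \<cdot> ((f \<cdot> f') \<cdot> g')" by (simp add: assoc)
  ultimately show ?thesis by (intro isoI[of _ "f' \<cdot> g'"]) (simp_all add: f' g')
qed

lemma iso_mono:
  assumes "iso_arr C m" "a \<in> Arr C" "b \<in> Arr C" "Cod C a = Dom C m" "Cod C b = Dom C m"
    "m \<cdot> a = m \<cdot> b"
  shows "a = b"
proof -
  note [simp] = iso_in_Arr[OF assms(1)] assms(2-5) Dom_in_Obj Cod_in_Obj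
  obtain n where [simp]: "n \<in> Arr C" "Dom C n = Cod C m" and n: "n \<cdot> m = Ident C (Dom C m)"
    using isoE[OF assms(1)] by metis
  have "(n \<cdot> m) \<cdot> a = (n \<cdot> m) \<cdot> b" using assms(6) by (simp add: assoc)
  then show ?thesis by (simp add: n)
qed

lemma iso_epi:
  assumes "iso_arr C m" "a \<in> Arr C" "b \<in> Arr C" "Dom C a = Cod C m" "Dom C b = Cod C m"
    "a \<cdot> m = b \<cdot> m"
  shows "a = b"
proof -
  note [simp] = iso_in_Arr[OF assms(1)] assms(2-5) Dom_in_Obj Cod_in_Obj
  obtain n where [simp]: "n \<in> Arr C" "Cod C n = Dom C m" "Dom C n = Cod C m"
    and n: "m \<cdot> n = Ident C (Cod C m)"
    using isoE[OF assms(1)] by metis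
  have "a \<cdot> (m \<cdot> n) = b \<cdot> (m \<cdot> n)" using assms(6) by (simp flip: assoc)
  then show ?thesis by (simp add: n)
qed

lemma pullbackI:
  assumes "f \<in> Arr C" "g \<in> Arr C" "p \<in> Arr C" "q \<in> Arr C"
    and "Cod C f = Cod C g" "Dom C q = Dom C p" "Cod C p = Dom C f" "Cod C q = Dom C g"
    and "f \<cdot> p = g \<cdot> q"
    and ex: "\<And>a b. \<lbrakk>a \<in> Arr C; b \<in> Arr C; Dom C a = Dom C b; Cod C a = Dom C f;
        Cod C b = Dom C g; f \<cdot> a = g \<cdot> b\<rbrakk>
      \<Longrightarrow> \<exists>k \<in> Arr C. Dom C k = Dom C b \<and> Cod C k = Dom C p \<and> p \<cdot> k = a \<and> q \<cdot> k = b"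
    and uniq: "\<And>k l. \<lbrakk>k \<in> Arr C; l \<in> Arr C; Dom C k = Dom C l; Cod C k = Dom C p;
        Cod C l = Dom C p; p \<cdot> k = p \<cdot> l; q \<cdot> k = q \<cdot> l\<rbrakk> \<Longrightarrow> k = l"
  shows "is_pullback C f g p q"
  unfolding is_pullback_def
proof (intro conjI allI ballI impI)
  fix x a b
  assume a: "a \<in> Hom C x (Dom C f)" and b: "b \<in> Hom C x (Dom C g)" and "f \<cdot> a = g \<cdot> b"
  then obtain k where "k \<in> Hom C x (Dom C p)" "p \<cdot> k = a" "q \<cdot> k = b"
    using ex[of a b] by (auto simp: Hom_def)
  then show "\<exists>!k. k \<in> Hom C x (Dom C p) \<and> p \<cdot> k = a \<and> q \<cdot> k = b"
    by (intro ex1I[of _ k]) (auto simp: Hom_def intro!: uniq)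
qed (use assms in \<open>auto simp: Hom_def\<close>)

lemma pullbackD:
  assumes "is_pullback C f g p q"
  shows "f \<in> Arr C" "g \<in> Arr C" "p \<in> Arr C" "q \<in> Arr C"
    "Cod C f = Cod C g" "Dom C q = Dom C p" "Cod C p = Dom C f" "Cod C q = Dom C g"
    "f \<cdot> p = g \<cdot> q"
  using assms by (auto simp: is_pullback_def Hom_def)

lemma pullback_liftE:
  assumes "is_pullback C f g p q"
    and "a \<in> Arr C" "b \<in> Arr C" "Dom C a = Dom C b" "Cod C a = Dom C f" "Cod C b = Dom C g"
    and "f \<cdot> a = g \<cdot> b"
  obtains k where "k \<in> Arr C" "Dom C k = Dom C b" "Cod C k = Dom C p" "p \<cdot> k = a" "q \<cdot> k = b"
proof -
  have "a \<in> Hom C (Dom C b) (Dom C f)" "b \<in> Hom C (Dom C b) (Dom C g)"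
    using assms by (auto simp: Hom_def)
  then obtain k where "k \<in> Hom C (Dom C b) (Dom C p)" "p \<cdot> k = a" "q \<cdot> k = b"
    using assms(1,7) unfolding is_pullback_def by blast
  then show ?thesis using that by (auto simp: Hom_def)
qed

lemma pullback_uniq:
  assumes "is_pullback C f g p q"
    and "k \<in> Arr C" "l \<in> Arr C" "Dom C k = Dom C l" "Cod C k = Dom C p" "Cod C l = Dom C p"
    and "p \<cdot> k = p \<cdot> l" "q \<cdot> k = q \<cdot> l"
  shows "k = l"
proof -
  note [simp] = pullbackD[OF assms(1)] assms(2-6)
  have *: "f \<cdot> (p \<cdot> l) = g \<cdot> (q \<cdot> l)" by (simp flip: assoc)
  have "p \<cdot> l \<in> Hom C (Dom C l) (Dom C f)" "q \<cdot> l \<in> Hom C (Dom C l) (Dom C g)"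
    by (auto simp: Hom_def)
  then have "\<exists>!m. m \<in> Hom C (Dom C l) (Dom C p) \<and> p \<cdot> m = p \<cdot> l \<and> q \<cdot> m = q \<cdot> l"
    using assms(1) * unfolding is_pullback_def by blast
  moreover have "k \<in> Hom C (Dom C l) (Dom C p)" "l \<in> Hom C (Dom C l) (Dom C p)"
    by (auto simp: Hom_def)
  ultimately show ?thesis using assms(7,8) by blast
qed

lemma pullback_Comp_iso:
  assumes pb: "is_pullback C f g p q" and i: "iso_arr C i" and cod: "Cod C i = Dom C p"
  shows "is_pullback C f g (p \<cdot> i) (q \<cdot> i)"
proof -
  note [simp] = pullbackD[OF pb] iso_in_Arr[OF i] cod Dom_in_Obj Cod_in_Obj
  obtain j where j [simp]: "j \<in> Arr C" "Dom C j = Dom C p" "Cod C j = Dom C i"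
    and ij: "i \<cdot> j = Ident C (Dom C p)" using isoE[OF i] cod by metis
  show ?thesis
  proof (rule pullbackI)
    show "f \<cdot> (p \<cdot> i) = g \<cdot> (q \<cdot> i)" by (simp flip: assoc)
  next
    fix a b
    assume ab [simp]: "a \<in> Arr C" "b \<in> Arr C" "Dom C a = Dom C b" "Cod C a = Dom C f"
      "Cod C b = Dom C g" "f \<cdot> a = g \<cdot> b"
    obtain k where k [simp]: "k \<in> Arr C" "Dom C k = Dom C b" "Cod C k = Dom C p"
      "p \<cdot> k = a" "q \<cdot> k = b" using pullback_liftE[OF pb ab] .
    have "i \<cdot> (j \<cdot> k) = k" using ij by (simp flip: assoc)
    then show "\<exists>k\<in>Arr C. Dom C k = Dom C b \<and> Cod C k = Dom C (p \<cdot> i) \<and> (p \<cdot> i) \<cdot> k = a \<and> (q \<cdot> i) \<cdot> k = b"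
      by (intro bexI[of _ "j \<cdot> k"]) (auto simp: assoc)
  next
    fix k l
    assume kl: "k \<in> Arr C" "l \<in> Arr C" "Dom C k = Dom C l" "Cod C k = Dom C (p \<cdot> i)"
      "Cod C l = Dom C (p \<cdot> i)" "(p \<cdot> i) \<cdot> k = (p \<cdot> i) \<cdot> l" "(q \<cdot> i) \<cdot> k = (q \<cdot> i) \<cdot> l"
    have "i \<cdot> k = i \<cdot> l"
      by (rule pullback_uniq[OF pb]) (use kl in \<open>auto simp: assoc\<close>)
    then show "k = l" by (rule iso_mono[OF i, rotated -1]) (use kl in auto)
  qed simp_all
qed

text \<open>Arrows between two pullbacks of the same cospan are unique, so the arrows induced in the two
  directions are mutually inverse.\<close>

lemma pullback_comparison_iso:
  assumes pb: "is_pullback C f g p q" and pb': "is_pullback C f g p' q'"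
    and k: "k \<in> Arr C" "Dom C k = Dom C p'" "Cod C k = Dom C p" "p \<cdot> k = p'" "q \<cdot> k = q'"
  shows "iso_arr C k"
proof -
  note [simp] = pullbackD[OF pb] pullbackD[OF pb'] Dom_in_Obj Cod_in_Obj
  obtain l where l: "l \<in> Arr C" "Dom C l = Dom C p" "Cod C l = Dom C p'" "p' \<cdot> l = p" "q' \<cdot> l = q"
    by (rule pullback_liftE[OF pb', of p q]) auto
  have "k \<cdot> l = Ident C (Dom C p)"
    by (rule pullback_uniq[OF pb]) (simp_all add: k l flip: assoc)
  moreover have "l \<cdot> k = Ident C (Dom C p')"
    by (rule pullback_uniq[OF pb']) (simp_all add: k l flip: assoc)
  ultimately show ?thesis using k l by (intro isoI[of k l]) auto
qed

lemma pullbacks_isoE: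
  assumes pb: "is_pullback C f g p q" and pb': "is_pullback C f g p' q'"
  obtains i where "iso_arr C i" "Dom C i = Dom C p'" "Cod C i = Dom C p" "p \<cdot> i = p'" "q \<cdot> i = q'"
proof -
  note [simp] = pullbackD[OF pb'] 
  obtain k where k: "k \<in> Arr C" "Dom C k = Dom C p'" "Cod C k = Dom C p" "p \<cdot> k = p'" "q \<cdot> k = q'"
    by (rule pullback_liftE[OF pb, of p' q']) auto
  with pullback_comparison_iso[OF pb pb'] that show ?thesis by blast
qed

text \<open>The identity is stable under pullback: the square on \<open>u\<close> and the identity of \<open>Dom u\<close> provides
  a section of \<open>q\<close>, which is an inverse by uniqueness.\<close>

lemma pullback_of_Ident_iso:
  assumes pb: "is_pullback C (Ident C d) u p q" and d: "d \<in> Obj C"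
  shows "iso_arr C q"
proof -
  note [simp] = pullbackD(1-4,6,8)[OF pb] d Dom_in_Obj Cod_in_Obj
  from d pullbackD(5)[OF pb] have [simp]: "Cod C u = d" by simp
  from d pullbackD(7)[OF pb] have [simp]: "Cod C p = d" by simp
  from pullbackD(9)[OF pb] have p: "p = u \<cdot> q" by simp
  obtain k where k: "k \<in> Arr C" "Dom C k = Dom C u" "Cod C k = Dom C p" "p \<cdot> k = u"
    "q \<cdot> k = Ident C (Dom C u)"
    by (rule pullback_liftE[OF pb, of u "Ident C (Dom C u)"]) auto
  have "p \<cdot> (k \<cdot> q) = p" by (simp add: k flip: assoc p)
  moreover have "q \<cdot> (k \<cdot> q) = q" by (simp add: k flip: assoc)
  ultimately have "k \<cdot> q = Ident C (Dom C p)"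
    by - (rule pullback_uniq[OF pb], simp_all add: k)
  with k show ?thesis by (intro isoI[of q k]) auto
qed

end

definition has_pullbacks :: "('o, 'a) cat \<Rightarrow> bool" where
  "has_pullbacks C \<longleftrightarrow> (\<forall>f \<in> Arr C. \<forall>g \<in> Arr C. Cod C f = Cod C g \<longrightarrow> (\<exists>p q. is_pullback C f g p q))"

lemma has_pullbacksE:
  assumes "has_pullbacks C" "f \<in> Arr C" "g \<in> Arr C" "Cod C f = Cod C g"
  obtains p q where "is_pullback C f g p q"
  using assms unfolding has_pullbacks_def by blast

context category
begin

lemma pb_is_pullback:
  assumes "has_pullbacks C" "f \<in> Arr C" "g \<in> Arr C" "Cod C f = Cod C g"
  shows "is_pullback C f g (pb_fst C f g) (pb_snd C f g)"
proof -
  have "\<exists>z. case z of (p, q) \<Rightarrow> is_pullback C f g p q"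
    using assms by (auto simp: has_pullbacks_def)
  then have "case pb C f g of (p, q) \<Rightarrow> is_pullback C f g p q"
    unfolding pb_def by (rule someI_ex)
  then show ?thesis by (simp add: pb_fst_def pb_snd_def case_prod_beta)
qed

lemma pb_lift:
  assumes pb: "is_pullback C f g (pb_fst C f g) (pb_snd C f g)"
    and "a \<in> Arr C" "b \<in> Arr C" "Dom C a = Dom C b" "Cod C a = Dom C f" "Cod C b = Dom C g"
    and "f \<cdot> a = g \<cdot> b"
  shows "pb_lift C f g a b \<in> Arr C" "Dom C (pb_lift C f g a b) = Dom C b"
    "Cod C (pb_lift C f g a b) = Dom C (pb_fst C f g)"
    "pb_fst C f g \<cdot> pb_lift C f g a b = a" "pb_snd C f g \<cdot> pb_lift C f g a b = b"
proof -
  let ?P = "\<lambda>k. k \<in> Hom C (Dom C a) (Dom C (pb_fst C f g)) \<and>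
     pb_fst C f g \<cdot> k = a \<and> pb_snd C f g \<cdot> k = b"
  have "a \<in> Hom C (Dom C a) (Dom C f)" "b \<in> Hom C (Dom C a) (Dom C g)"
    using assms by (auto simp: Hom_def)
  then have "\<exists>!k. ?P k" using pb assms(7) unfolding is_pullback_def by blast
  then have "?P (pb_lift C f g a b)" unfolding pb_lift_def by (rule theI')
  then show "pb_lift C f g a b \<in> Arr C" "Dom C (pb_lift C f g a b) = Dom C b"
    "Cod C (pb_lift C f g a b) = Dom C (pb_fst C f g)"
    "pb_fst C f g \<cdot> pb_lift C f g a b = a" "pb_snd C f g \<cdot> pb_lift C f g a b = b"
    using assms(4) by (auto simp: Hom_def)
qed

end


section \<open>Adjoint transposition and fibrations\<close>

context is_functor
begin

lemma FObj_Obj [simp]: "a \<in> Obj C \<Longrightarrow> FObj F a \<in> Obj D"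
  by (rule FObj_in_Obj)

lemma FArr_Arr [simp]: "f \<in> Arr C \<Longrightarrow> FArr F f \<in> Arr D"
  and Dom_FArr [simp]: "f \<in> Arr C \<Longrightarrow> Dom D (FArr F f) = FObj F (Dom C f)"
  and Cod_FArr [simp]: "f \<in> Arr C \<Longrightarrow> Cod D (FArr F f) = FObj F (Cod C f)"
  using FArr_in_Hom[of f "Dom C f" "Cod C f"] by (auto simp: Hom_def)

lemma FArr_Comp': "\<lbrakk>f \<in> Arr C; g \<in> Arr C; Dom C g = Cod C f\<rbrakk>
    \<Longrightarrow> FArr F (g \<cdot>\<^bsub>C\<^esub> f) = FArr F g \<cdot>\<^bsub>D\<^esub> FArr F f"
  using FArr_Comp[of f "Dom C f" "Cod C f" g "Cod C g"] by (auto simp: Hom_def)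

lemma FArr_iso:
  assumes "iso_arr C f"
  shows "iso_arr D (FArr F f)"
proof -
  note [simp] = C.iso_in_Arr[OF assms] C.Dom_in_Obj C.Cod_in_Obj
  obtain g where "g \<in> Arr C" "Dom C g = Cod C f" "Cod C g = Dom C f"
    "g \<cdot>\<^bsub>C\<^esub> f = Ident C (Dom C f)" "f \<cdot>\<^bsub>C\<^esub> g = Ident C (Cod C f)"
    using C.isoE[OF assms] .
  then show ?thesis
    by (intro D.isoI[of _ "FArr F g"]) (simp_all flip: FArr_Comp' FArr_Ident)
qed

end

locale adjoint_functors = C: category C + D: category D + L: is_functor C D L + R: is_functor D C R
  for C :: "('o, 'a) cat" and D :: "('p, 'b) cat" and L R +
  fixes \<eta> \<epsilon>
  assumes adj: "adjunction C D L R \<eta> \<epsilon>"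
begin

text \<open>The transpose \<open>L a \<rightarrow> d\<close> of an arrow \<open>\<alpha> : a \<rightarrow> R d\<close>.  The object \<open>d\<close> is an explicit argument
  because it cannot be recovered from the codomain \<open>R d\<close> of \<open>\<alpha>\<close>.\<close>

definition flat where "flat d \<alpha> = \<epsilon> d \<cdot>\<^bsub>D\<^esub> FArr L \<alpha>"

lemma unit_Arr [simp]: "c \<in> Obj C \<Longrightarrow> \<eta> c \<in> Arr C"
  and Dom_unit [simp]: "c \<in> Obj C \<Longrightarrow> Dom C (\<eta> c) = c"
  and Cod_unit [simp]: "c \<in> Obj C \<Longrightarrow> Cod C (\<eta> c) = FObj R (FObj L c)"
  and counit_Arr [simp]: "d \<in> Obj D \<Longrightarrow> \<epsilon> d \<in> Arr D"
  and Dom_counit [simp]: "d \<in> Obj D \<Longrightarrow> Dom D (\<epsilon> d) = FObj L (FObj R d)"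
  and Cod_counit [simp]: "d \<in> Obj D \<Longrightarrow> Cod D (\<epsilon> d) = d"
  using adj unfolding adjunction_def nat_trans_def comp_ftr_def id_ftr_def by (auto simp: Hom_def)

lemma unit_nat: "f \<in> Arr C \<Longrightarrow> \<eta> (Cod C f) \<cdot>\<^bsub>C\<^esub> f = FArr R (FArr L f) \<cdot>\<^bsub>C\<^esub> \<eta> (Dom C f)"
  and counit_nat: "g \<in> Arr D \<Longrightarrow> \<epsilon> (Cod D g) \<cdot>\<^bsub>D\<^esub> FArr L (FArr R g) = g \<cdot>\<^bsub>D\<^esub> \<epsilon> (Dom D g)"
  and triangle_L: "c \<in> Obj C \<Longrightarrow> \<epsilon> (FObj L c) \<cdot>\<^bsub>D\<^esub> FArr L (\<eta> c) = Ident D (FObj L c)"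
  and triangle_R: "d \<in> Obj D \<Longrightarrow> FArr R (\<epsilon> d) \<cdot>\<^bsub>C\<^esub> \<eta> (FObj R d) = Ident C (FObj R d)"
  using adj unfolding adjunction_def nat_trans_def comp_ftr_def id_ftr_def by auto

context
  fixes d assumes d [simp]: "d \<in> Obj D"
begin

lemma flat_Arr [simp]: "\<lbrakk>\<alpha> \<in> Arr C; Cod C \<alpha> = FObj R d\<rbrakk> \<Longrightarrow> flat d \<alpha> \<in> Arr D"
  and Dom_flat [simp]: "\<lbrakk>\<alpha> \<in> Arr C; Cod C \<alpha> = FObj R d\<rbrakk> \<Longrightarrow> Dom D (flat d \<alpha>) = FObj L (Dom C \<alpha>)"
  and Cod_flat [simp]: "\<lbrakk>\<alpha> \<in> Arr C; Cod C \<alpha> = FObj R d\<rbrakk> \<Longrightarrow> Cod D (flat d \<alpha>) = d"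
  by (simp_all add: flat_def)

lemma flat_Comp:
  "\<lbrakk>\<alpha> \<in> Arr C; Cod C \<alpha> = FObj R d; k \<in> Arr C; Cod C k = Dom C \<alpha>\<rbrakk>
    \<Longrightarrow> flat d (\<alpha> \<cdot>\<^bsub>C\<^esub> k) = flat d \<alpha> \<cdot>\<^bsub>D\<^esub> FArr L k"
  by (simp add: flat_def L.FArr_Comp' D.assoc)

lemma sharp_flat:
  assumes "\<alpha> \<in> Arr C" "Cod C \<alpha> = FObj R d"
  shows "FArr R (flat d \<alpha>) \<cdot>\<^bsub>C\<^esub> \<eta> (Dom C \<alpha>) = \<alpha>"
proof -
  note [simp] = assms C.Dom_in_Obj
  have "FArr R (flat d \<alpha>) \<cdot>\<^bsub>C\<^esub> \<eta> (Dom C \<alpha>) = FArr R (\<epsilon> d) \<cdot>\<^bsub>C\<^esub> (\<eta> (FObj R d) \<cdot>\<^bsub>C\<^esub> \<alpha>)"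
    using unit_nat[of \<alpha>] by (simp add: flat_def R.FArr_Comp' C.assoc)
  also have "\<dots> = \<alpha>" by (simp add: triangle_R flip: C.assoc)
  finally show ?thesis .
qed

lemma flat_inj:
  "\<lbrakk>\<alpha> \<in> Arr C; Cod C \<alpha> = FObj R d; \<beta> \<in> Arr C; Cod C \<beta> = FObj R d; Dom C \<alpha> = Dom C \<beta>;
    flat d \<alpha> = flat d \<beta>\<rbrakk> \<Longrightarrow> \<alpha> = \<beta>"
  by (metis sharp_flat)

lemma flat_surjE:
  assumes "\<beta> \<in> Arr D" "Cod D \<beta> = d" "Dom D \<beta> = FObj L c" "c \<in> Obj C"
  obtains \<alpha> where "\<alpha> \<in> Arr C" "Dom C \<alpha> = c" "Cod C \<alpha> = FObj R d" "flat d \<alpha> = \<beta>"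
proof -
  note [simp] = assms
  have "flat d (FArr R \<beta> \<cdot>\<^bsub>C\<^esub> \<eta> c) = (\<epsilon> d \<cdot>\<^bsub>D\<^esub> FArr L (FArr R \<beta>)) \<cdot>\<^bsub>D\<^esub> FArr L (\<eta> c)"
    by (simp add: flat_def L.FArr_Comp' D.assoc)
  also have "\<dots> = \<beta> \<cdot>\<^bsub>D\<^esub> (\<epsilon> (FObj L c) \<cdot>\<^bsub>D\<^esub> FArr L (\<eta> c))"
    using counit_nat[of \<beta>] by (simp add: D.assoc)
  also have "\<dots> = \<beta>" by (simp add: triangle_L)
  finally show ?thesis by (intro that[of "FArr R \<beta> \<cdot>\<^bsub>C\<^esub> \<eta> c"]) simp_all
qed

end

lemma flat_FArr_Comp:
  assumes "h \<in> Arr D" "\<alpha> \<in> Arr C" "Cod C \<alpha> = FObj R (Dom D h)"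
  shows "flat (Cod D h) (FArr R h \<cdot>\<^bsub>C\<^esub> \<alpha>) = h \<cdot>\<^bsub>D\<^esub> flat (Dom D h) \<alpha>"
proof -
  note [simp] = assms D.Dom_in_Obj D.Cod_in_Obj
  have "flat (Cod D h) (FArr R h \<cdot>\<^bsub>C\<^esub> \<alpha>) = (\<epsilon> (Cod D h) \<cdot>\<^bsub>D\<^esub> FArr L (FArr R h)) \<cdot>\<^bsub>D\<^esub> FArr L \<alpha>"
    by (simp add: flat_def L.FArr_Comp' D.assoc)
  also have "\<dots> = h \<cdot>\<^bsub>D\<^esub> flat (Dom D h) \<alpha>"
    using counit_nat[of h] by (simp add: flat_def D.assoc)
  finally show ?thesis .
qed

lemma flat_unit: "c \<in> Obj C \<Longrightarrow> flat (FObj L c) (\<eta> c) = Ident D (FObj L c)"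
  by (simp add: flat_def triangle_L)

text \<open>A pullback of \<open>\<alpha> : a \<rightarrow> R e\<close> along \<open>R h\<close> is transposed into a commutative square over \<open>h\<close>;
  the condition says that this square is again a pullback.  It is the Beck-Chevalley condition for
  \<open>L\<close>, phrased without chosen pullbacks and without slices.\<close>

definition transposes_pullbacks :: bool where
  "transposes_pullbacks \<longleftrightarrow>
     (\<forall>h \<in> Arr D. \<forall>\<alpha> p q. is_pullback C \<alpha> (FArr R h) p q \<longrightarrow>
        is_pullback D (flat (Cod D h) \<alpha>) h (FArr L p) (flat (Dom D h) q))"

text \<open>To lift \<open>u : c \<rightarrow> L d\<close>, pull the unit \<open>d \<rightarrow> R (L d)\<close> back along \<open>R u\<close>, with projections \<open>p\<close> to
  \<open>d\<close> and \<open>q\<close> to \<open>R c\<close>.  The unit is transposed to an identity, so the transpose \<open>\<sigma>\<close> of \<open>q\<close> is a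
  pullback of an identity, hence invertible, and \<open>L p = u \<sigma>\<close>.  The arrow \<open>p\<close> is cartesian because,
  \<open>\<sigma>\<close> being invertible, prescribing \<open>L k\<close> amounts to prescribing \<open>q k\<close>, so that the universal
  property of a cartesian arrow becomes that of the pullback.\<close>

lemma fibration_if_transposes_pullbacks:
  assumes pbs: "has_pullbacks C" and tp: "transposes_pullbacks"
  shows "street_fibration C D L"
  unfolding street_fibration_def
proof (intro conjI ballI impI)
  show "is_functor C D L" by unfold_locales
next
  fix d u
  assume [simp]: "d \<in> Obj C" "u \<in> Arr D" "Cod D u = FObj L d"
  note [simp] = D.Dom_in_Obj C.Dom_in_Obj
  obtain p q where pb: "is_pullback C (\<eta> d) (FArr R u) p q"
    by (rule has_pullbacksE[OF pbs, of "\<eta> d" "FArr R u"]) simp_all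
  note pbD = C.pullbackD[OF pb]
  have [simp]: "p \<in> Arr C" "q \<in> Arr C" "Dom C q = Dom C p" "Cod C p = d"
    "Cod C q = FObj R (Dom D u)" using pbD by auto
  let ?\<sigma> = "flat (Dom D u) q"
  have pb': "is_pullback D (Ident D (FObj L d)) u (FArr L p) ?\<sigma>"
    using tp pb unfolding transposes_pullbacks_def by (metis \<open>u \<in> Arr D\<close> \<open>d \<in> Obj C\<close>
      \<open>Cod D u = FObj L d\<close> flat_unit)
  have iso: "iso_arr D ?\<sigma>" by (rule D.pullback_of_Ident_iso[OF pb']) simp
  have Lp: "FArr L p = u \<cdot>\<^bsub>D\<^esub> ?\<sigma>" using D.pullbackD(9)[OF pb'] by simp
  have "cartesian C D L p" unfolding cartesian_def
  proof (intro conjI ballI impI)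
    fix g h
    assume g [simp]: "g \<in> Arr C" and h: "h \<in> Hom D (FObj L (Dom C g)) (FObj L (Dom C p))"
      and gh: "Cod C g = Cod C p \<and> FArr L p \<cdot>\<^bsub>D\<^esub> h = FArr L g"
    from h have [simp]: "h \<in> Arr D" "Dom D h = FObj L (Dom C g)" "Cod D h = FObj L (Dom C p)"
      by (auto simp: Hom_def)
    from gh have [simp]: "Cod C g = d" by simp
    obtain y where y [simp]: "y \<in> Arr C" "Dom C y = Dom C g" "Cod C y = FObj R (Dom D u)"
      and fy: "flat (Dom D u) y = ?\<sigma> \<cdot>\<^bsub>D\<^esub> h"
      by (rule flat_surjE[of "Dom D u" "?\<sigma> \<cdot>\<^bsub>D\<^esub> h" "Dom C g"]) simp_all
    have "flat (FObj L d) (\<eta> d \<cdot>\<^bsub>C\<^esub> g) = flat (FObj L d) (FArr R u \<cdot>\<^bsub>C\<^esub> y)"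
      using flat_FArr_Comp[of u y] gh
      by (simp add: flat_Comp[where \<alpha> = "\<eta> d"] flat_unit fy Lp D.assoc)
    then have "\<eta> d \<cdot>\<^bsub>C\<^esub> g = FArr R u \<cdot>\<^bsub>C\<^esub> y"
      by (rule flat_inj[rotated -1]) simp_all
    then obtain k where k: "k \<in> Arr C" "Dom C k = Dom C y" "Cod C k = Dom C p" "p \<cdot>\<^bsub>C\<^esub> k = g"
      "q \<cdot>\<^bsub>C\<^esub> k = y"
      using C.pullback_liftE[OF pb, of g y] by auto
    \<comment> \<open>both sides are compared through their transposes, \<open>\<sigma> (L k)\<close> and \<open>\<sigma> h\<close>\<close>
    have *: "FArr L k = h \<longleftrightarrow> q \<cdot>\<^bsub>C\<^esub> k = y"
      if k: "k \<in> Arr C" "Dom C k = Dom C g" "Cod C k = Dom C p" for k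
    proof
      assume "FArr L k = h"
      with k have "flat (Dom D u) (q \<cdot>\<^bsub>C\<^esub> k) = flat (Dom D u) y" by (simp add: flat_Comp fy)
      then show "q \<cdot>\<^bsub>C\<^esub> k = y" by (rule flat_inj[rotated -1]) (simp_all add: k)
    next
      assume "q \<cdot>\<^bsub>C\<^esub> k = y"
      then have "flat (Dom D u) (q \<cdot>\<^bsub>C\<^esub> k) = flat (Dom D u) y" by simp
      with k have "?\<sigma> \<cdot>\<^bsub>D\<^esub> FArr L k = ?\<sigma> \<cdot>\<^bsub>D\<^esub> h" by (simp add: flat_Comp fy)
      then show "FArr L k = h" by (rule D.iso_mono[OF iso, rotated -1]) (simp_all add: k)
    qed
    show "\<exists>!h'. h' \<in> Hom C (Dom C g) (Dom C p) \<and> FArr L h' = h \<and> p \<cdot>\<^bsub>C\<^esub> h' = g"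
    proof (rule ex1I[of _ k])
      show "k \<in> Hom C (Dom C g) (Dom C p) \<and> FArr L k = h \<and> p \<cdot>\<^bsub>C\<^esub> k = g"
        using k * by (auto simp: Hom_def)
    next
      fix l
      assume "l \<in> Hom C (Dom C g) (Dom C p) \<and> FArr L l = h \<and> p \<cdot>\<^bsub>C\<^esub> l = g"
      with k * show "l = k" by - (rule C.pullback_uniq[OF pb], auto simp: Hom_def)
    qed
  qed simp
  with iso Lp show "\<exists>v \<sigma>. cartesian C D L v \<and> Cod C v = d \<and>
           \<sigma> \<in> Hom D (FObj L (Dom C v)) (Dom D u) \<and> iso_arr D \<sigma> \<and> FArr L v = u \<cdot>\<^bsub>D\<^esub> \<sigma>"
    by (intro exI[of _ p] exI[of _ ?\<sigma>]) (simp add: Hom_def)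
qed

text \<open>Let \<open>u\<close>, \<open>w\<close> be a pullback of the transpose of \<open>\<alpha>\<close> along \<open>h\<close>.  A cartesian lift \<open>v\<close> of \<open>u\<close>,
  with \<open>L v = u \<sigma>\<close>, together with the arrow \<open>r\<close> whose transpose is \<open>w \<sigma>\<close>, is a pullback of \<open>\<alpha>\<close>
  along \<open>R h\<close>.  It is transposed to \<open>u \<sigma>\<close>, \<open>w \<sigma>\<close>, which is a pullback; and any other pullback of
  \<open>\<alpha>\<close> along \<open>R h\<close> differs from it by an isomorphism, which \<open>L\<close> preserves.\<close>

lemma transposes_pullbacks_if_fibration:
  assumes pbs: "has_pullbacks D" and fib: "street_fibration C D L"
  shows "transposes_pullbacks"
  unfolding transposes_pullbacks_def
proof (intro ballI allI impI)
  fix h \<alpha> p q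
  assume h [simp]: "h \<in> Arr D" and pb: "is_pullback C \<alpha> (FArr R h) p q"
  note [simp] = D.Dom_in_Obj D.Cod_in_Obj C.Dom_in_Obj
  have [simp]: "\<alpha> \<in> Arr C" "p \<in> Arr C" "q \<in> Arr C" "Dom C q = Dom C p" "Cod C p = Dom C \<alpha>"
    "Cod C \<alpha> = FObj R (Cod D h)" "Cod C q = FObj R (Dom D h)"
    using C.pullbackD[OF pb] by auto
  let ?\<alpha> = "flat (Cod D h) \<alpha>"
  obtain u w where pbE: "is_pullback D ?\<alpha> h u w"
    by (rule has_pullbacksE[OF pbs, of ?\<alpha> h]) simp_all
  have [simp]: "u \<in> Arr D" "w \<in> Arr D" "Dom D w = Dom D u" "Cod D u = FObj L (Dom C \<alpha>)"
    "Cod D w = Dom D h" and sq: "?\<alpha> \<cdot>\<^bsub>D\<^esub> u = h \<cdot>\<^bsub>D\<^esub> w"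
    using D.pullbackD[OF pbE] by auto
  obtain v \<sigma> where cart: "cartesian C D L v" and [simp]: "Cod C v = Dom C \<alpha>"
    and iso: "iso_arr D \<sigma>" and \<sigma>: "\<sigma> \<in> Hom D (FObj L (Dom C v)) (Dom D u)"
    and Lv: "FArr L v = u \<cdot>\<^bsub>D\<^esub> \<sigma>"
    using fib unfolding street_fibration_def by (metis C.Dom_in_Obj \<open>\<alpha> \<in> Arr C\<close> \<open>u \<in> Arr D\<close>
      \<open>Cod D u = FObj L (Dom C \<alpha>)\<close>)
  from \<sigma> have [simp]: "\<sigma> \<in> Arr D" "Dom D \<sigma> = FObj L (Dom C v)" "Cod D \<sigma> = Dom D u"
    by (auto simp: Hom_def)
  from cart have [simp]: "v \<in> Arr C" by (simp add: cartesian_def)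
  obtain r where [simp]: "r \<in> Arr C" "Dom C r = Dom C v" "Cod C r = FObj R (Dom D h)"
    and fr: "flat (Dom D h) r = w \<cdot>\<^bsub>D\<^esub> \<sigma>"
    by (rule flat_surjE[of "Dom D h" "w \<cdot>\<^bsub>D\<^esub> \<sigma>" "Dom C v"]) simp_all
  have pb': "is_pullback C \<alpha> (FArr R h) v r"
  proof (rule C.pullbackI)
    have "?\<alpha> \<cdot>\<^bsub>D\<^esub> (u \<cdot>\<^bsub>D\<^esub> \<sigma>) = h \<cdot>\<^bsub>D\<^esub> (w \<cdot>\<^bsub>D\<^esub> \<sigma>)" by (simp add: sq flip: D.assoc)
    then have "flat (Cod D h) (\<alpha> \<cdot>\<^bsub>C\<^esub> v) = flat (Cod D h) (FArr R h \<cdot>\<^bsub>C\<^esub> r)"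
      by (simp add: flat_Comp[where \<alpha> = \<alpha>] flat_FArr_Comp Lv fr)
    then show "\<alpha> \<cdot>\<^bsub>C\<^esub> v = FArr R h \<cdot>\<^bsub>C\<^esub> r"
      by (rule flat_inj[rotated -1]) simp_all
  next
    fix a b
    assume [simp]: "a \<in> Arr C" "b \<in> Arr C" "Dom C a = Dom C b" "Cod C a = Dom C \<alpha>"
      and "Cod C b = Dom C (FArr R h)" and ab: "\<alpha> \<cdot>\<^bsub>C\<^esub> a = FArr R h \<cdot>\<^bsub>C\<^esub> b"
    then have [simp]: "Cod C b = FObj R (Dom D h)" by simp
    from ab have "flat (Cod D h) (\<alpha> \<cdot>\<^bsub>C\<^esub> a) = flat (Cod D h) (FArr R h \<cdot>\<^bsub>C\<^esub> b)" by simp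
    then have "?\<alpha> \<cdot>\<^bsub>D\<^esub> FArr L a = h \<cdot>\<^bsub>D\<^esub> flat (Dom D h) b"
      by (simp add: flat_Comp[where \<alpha> = \<alpha>] flat_FArr_Comp)
    then obtain k where [simp]: "k \<in> Arr D" "Dom D k = FObj L (Dom C b)" "Cod D k = Dom D u"
      and uk: "u \<cdot>\<^bsub>D\<^esub> k = FArr L a" and wk: "w \<cdot>\<^bsub>D\<^esub> k = flat (Dom D h) b"
      using D.pullback_liftE[OF pbE, of "FArr L a" "flat (Dom D h) b"] by auto
    obtain \<tau> where [simp]: "\<tau> \<in> Arr D" "Dom D \<tau> = Dom D u" "Cod D \<tau> = FObj L (Dom C v)"
      and \<sigma>\<tau>: "\<sigma> \<cdot>\<^bsub>D\<^esub> \<tau> = Ident D (Dom D u)" using D.isoE[OF iso] by force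
    \<comment> \<open>\<open>\<tau> k\<close> is the arrow over which \<open>a\<close> has to be factored through the cartesian \<open>v\<close>\<close>
    have \<sigma>\<tau>k: "\<sigma> \<cdot>\<^bsub>D\<^esub> (\<tau> \<cdot>\<^bsub>D\<^esub> k) = k" by (simp add: \<sigma>\<tau> flip: D.assoc)
    have "\<tau> \<cdot>\<^bsub>D\<^esub> k \<in> Hom D (FObj L (Dom C a)) (FObj L (Dom C v))" by (simp add: Hom_def)
    moreover have "FArr L v \<cdot>\<^bsub>D\<^esub> (\<tau> \<cdot>\<^bsub>D\<^esub> k) = FArr L a" by (simp add: Lv D.assoc \<sigma>\<tau>k uk)
    ultimately obtain l where "l \<in> Hom C (Dom C a) (Dom C v)" and Ll: "FArr L l = \<tau> \<cdot>\<^bsub>D\<^esub> k"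
      and vl: "v \<cdot>\<^bsub>C\<^esub> l = a"
      using cart \<open>a \<in> Arr C\<close> unfolding cartesian_def
      by (metis \<open>Cod C a = Dom C \<alpha>\<close> \<open>Cod C v = Dom C \<alpha>\<close>)
    then have [simp]: "l \<in> Arr C" "Dom C l = Dom C b" "Cod C l = Dom C v" by (auto simp: Hom_def)
    have "flat (Dom D h) (r \<cdot>\<^bsub>C\<^esub> l) = flat (Dom D h) b"
      by (simp add: flat_Comp fr Ll D.assoc \<sigma>\<tau>k wk)
    then have "r \<cdot>\<^bsub>C\<^esub> l = b" by (rule flat_inj[rotated -1]) simp_all
    with vl show "\<exists>k\<in>Arr C. Dom C k = Dom C b \<and> Cod C k = Dom C v \<and> v \<cdot>\<^bsub>C\<^esub> k = a \<and> r \<cdot>\<^bsub>C\<^esub> k = b"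
      by (intro bexI[of _ l]) simp_all
  next
    fix k l
    assume [simp]: "k \<in> Arr C" "l \<in> Arr C" "Dom C k = Dom C l" "Cod C k = Dom C v" "Cod C l = Dom C v"
      and v: "v \<cdot>\<^bsub>C\<^esub> k = v \<cdot>\<^bsub>C\<^esub> l" and r: "r \<cdot>\<^bsub>C\<^esub> k = r \<cdot>\<^bsub>C\<^esub> l"
    have "FArr L (v \<cdot>\<^bsub>C\<^esub> k) = FArr L (v \<cdot>\<^bsub>C\<^esub> l)" by (simp add: v)
    moreover have "flat (Dom D h) (r \<cdot>\<^bsub>C\<^esub> k) = flat (Dom D h) (r \<cdot>\<^bsub>C\<^esub> l)" by (simp add: r)
    ultimately have "\<sigma> \<cdot>\<^bsub>D\<^esub> FArr L k = \<sigma> \<cdot>\<^bsub>D\<^esub> FArr L l"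
      by - (rule D.pullback_uniq[OF pbE],
        simp_all add: flat_Comp[where \<alpha> = r] fr Lv L.FArr_Comp' D.assoc)
    then have Lkl: "FArr L k = FArr L l" by (rule D.iso_mono[OF iso, rotated -1]) simp_all
    have "v \<cdot>\<^bsub>C\<^esub> l \<in> Arr C" "Cod C (v \<cdot>\<^bsub>C\<^esub> l) = Cod C v" by simp_all
    moreover have "FArr L l \<in> Hom D (FObj L (Dom C (v \<cdot>\<^bsub>C\<^esub> l))) (FObj L (Dom C v))"
      by (simp add: Hom_def)
    moreover have "FArr L v \<cdot>\<^bsub>D\<^esub> FArr L l = FArr L (v \<cdot>\<^bsub>C\<^esub> l)" by (simp add: L.FArr_Comp')
    ultimately have "\<exists>!m. m \<in> Hom C (Dom C (v \<cdot>\<^bsub>C\<^esub> l)) (Dom C v) \<and> FArr L m = FArr L l \<and>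
        v \<cdot>\<^bsub>C\<^esub> m = v \<cdot>\<^bsub>C\<^esub> l"
      using cart unfolding cartesian_def by blast
    moreover have "k \<in> Hom C (Dom C (v \<cdot>\<^bsub>C\<^esub> l)) (Dom C v)"
      "l \<in> Hom C (Dom C (v \<cdot>\<^bsub>C\<^esub> l)) (Dom C v)"
      by (simp_all add: Hom_def)
    ultimately show "k = l" using v Lkl by blast
  qed simp_all
  obtain i where i: "iso_arr C i" and [simp]: "Dom C i = Dom C p" "Cod C i = Dom C v"
    and vi: "v \<cdot>\<^bsub>C\<^esub> i = p" and ri: "r \<cdot>\<^bsub>C\<^esub> i = q"
    using C.pullbacks_isoE[OF pb' pb] .
  note [simp] = C.iso_in_Arr[OF i]
  have "is_pullback D ?\<alpha> h (u \<cdot>\<^bsub>D\<^esub> (\<sigma> \<cdot>\<^bsub>D\<^esub> FArr L i)) (w \<cdot>\<^bsub>D\<^esub> (\<sigma> \<cdot>\<^bsub>D\<^esub> FArr L i))"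
    by (intro D.pullback_Comp_iso[OF pbE] D.iso_Comp L.FArr_iso i iso) simp_all
  moreover have "u \<cdot>\<^bsub>D\<^esub> (\<sigma> \<cdot>\<^bsub>D\<^esub> FArr L i) = FArr L p"
    by (simp add: Lv L.FArr_Comp' D.assoc flip: vi)
  moreover have "w \<cdot>\<^bsub>D\<^esub> (\<sigma> \<cdot>\<^bsub>D\<^esub> FArr L i) = flat (Dom D h) q"
    by (simp add: fr flat_Comp D.assoc flip: ri)
  ultimately show "is_pullback D ?\<alpha> h (FArr L p) (flat (Dom D h) q)" by simp
qed

end


section \<open>Local connectedness in terms of pullback squares\<close>

lemma slice_simps [simp]:
  "Obj (slice C c) = {x \<in> Arr C. Cod C x = c}"
  "(x, g, y) \<in> Arr (slice C c) \<longleftrightarrow> x \<in> Arr C \<and> Cod C x = c \<and> y \<in> Arr C \<and> Cod C y = c \<and>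
     g \<in> Arr C \<and> Dom C g = Dom C x \<and> Cod C g = Dom C y \<and> y \<cdot>\<^bsub>C\<^esub> g = x"
  "Dom (slice C c) (x, g, y) = x"
  "Cod (slice C c) (x, g, y) = y"
  "Ident (slice C c) x = (x, Ident C (Dom C x), x)"
  "Comp (slice C c) (y', k, z) (x, g, y) = (x, k \<cdot>\<^bsub>C\<^esub> g, z)"
  by (auto simp: slice_def Hom_def)

context category
begin

lemma slice_category: "category (slice C c)"
proof
  fix g assume "g \<in> Arr (slice C c)"
  then show "Dom (slice C c) g \<in> Obj (slice C c)" by (cases g) simp
next
  fix g assume "g \<in> Arr (slice C c)"
  then show "Cod (slice C c) g \<in> Obj (slice C c)" by (cases g) simp
next
  fix x assume "x \<in> Obj (slice C c)"
  then show "Ident (slice C c) x \<in> Hom (slice C c) x x" by (simp add: Hom_def Dom_in_Obj)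
next
  fix g k x y z
  assume "g \<in> Hom (slice C c) x y" "k \<in> Hom (slice C c) y z"
  then show "k \<cdot>\<^bsub>slice C c\<^esub> g \<in> Hom (slice C c) x z"
    by (cases g; cases k) (simp add: Hom_def flip: assoc)
next
  fix g x y
  assume "g \<in> Hom (slice C c) x y"
  then show "g \<cdot>\<^bsub>slice C c\<^esub> Ident (slice C c) x = g"
    "Ident (slice C c) y \<cdot>\<^bsub>slice C c\<^esub> g = g"
    by (cases g; auto simp add: Hom_def)+
next
  fix g k l x y z w
  assume "g \<in> Hom (slice C c) x y" "k \<in> Hom (slice C c) y z" "l \<in> Hom (slice C c) z w"
  then show "(l \<cdot>\<^bsub>slice C c\<^esub> k) \<cdot>\<^bsub>slice C c\<^esub> g = l \<cdot>\<^bsub>slice C c\<^esub> (k \<cdot>\<^bsub>slice C c\<^esub> g)"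
    by (cases g; cases k; cases l) (auto simp: Hom_def assoc)
qed

lemma slice_iso_iff:
  assumes "(x, g, y) \<in> Arr (slice C c)"
  shows "iso_arr (slice C c) (x, g, y) \<longleftrightarrow> iso_arr C g"
proof
  note [simp] = Dom_in_Obj Cod_in_Obj
  have [simp]: "x \<in> Arr C" "Cod C x = c" "y \<in> Arr C" "Cod C y = c" "g \<in> Arr C"
    "Dom C g = Dom C x" "Cod C g = Dom C y" and yg: "y \<cdot> g = x" using assms by auto
  {
    assume "iso_arr (slice C c) (x, g, y)"
    then obtain t where "t \<in> Arr (slice C c)" "Dom (slice C c) t = y" "Cod (slice C c) t = x"
      and t: "t \<cdot>\<^bsub>slice C c\<^esub> (x, g, y) = Ident (slice C c) x"
        "(x, g, y) \<cdot>\<^bsub>slice C c\<^esub> t = Ident (slice C c) y"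
      using category.isoE[OF slice_category, of c "(x, g, y)"] by (metis slice_simps(3,4))
    then obtain k where "k \<in> Arr C" "Dom C k = Dom C y" "Cod C k = Dom C x" and "t = (y, k, x)"
      by (cases t) simp
    with t show "iso_arr C g" by (intro isoI[of g k]) simp_all
  next
    assume "iso_arr C g"
    then obtain k where [simp]: "k \<in> Arr C" "Dom C k = Dom C y" "Cod C k = Dom C x"
      and k: "k \<cdot> g = Ident C (Dom C x)" "g \<cdot> k = Ident C (Dom C y)"
      using isoE[of g] by (metis \<open>Dom C g = Dom C x\<close> \<open>Cod C g = Dom C y\<close>)
    have "x \<cdot> k = y \<cdot> (g \<cdot> k)" by (simp add: yg flip: assoc)
    then have "x \<cdot> k = y" by (simp add: k)
    then show "iso_arr (slice C c) (x, g, y)"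
      by (intro category.isoI[OF slice_category, of _ _ "(y, k, x)"]) (simp_all add: k yg)
  }
qed

lemma pullback_ftr_is_functor:
  assumes pbs: "has_pullbacks C" and h [simp]: "h \<in> Arr C"
  shows "is_functor (slice C (Cod C h)) (slice C (Dom C h)) (pullback_ftr C h)"
proof -
  interpret S: category "slice C (Cod C h)" by (rule slice_category)
  interpret T: category "slice C (Dom C h)" by (rule slice_category)
  note [simp] = Dom_in_Obj Cod_in_Obj
  note pb = pb_is_pullback[OF pbs _ h]
  have pbD [simp]: "pb_fst C x h \<in> Arr C" "pb_snd C x h \<in> Arr C"
    "Dom C (pb_snd C x h) = Dom C (pb_fst C x h)" "Cod C (pb_fst C x h) = Dom C x"
    "Cod C (pb_snd C x h) = Dom C h" "x \<cdot> pb_fst C x h = h \<cdot> pb_snd C x h"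
    if "x \<in> Arr C" "Cod C x = Cod C h" for x
    using pullbackD[OF pb[OF that]] by simp_all
  define lift where
    "lift x g y = pb_lift C y h (g \<cdot> pb_fst C x h) (pb_snd C x h)" for x g y
  have lift: "lift x g y \<in> Arr C" "Dom C (lift x g y) = Dom C (pb_fst C x h)"
    "Cod C (lift x g y) = Dom C (pb_fst C y h)"
    "pb_fst C y h \<cdot> lift x g y = g \<cdot> pb_fst C x h" "pb_snd C y h \<cdot> lift x g y = pb_snd C x h"
    if "(x, g, y) \<in> Arr (slice C (Cod C h))" for x g y
  proof -
    have [simp]: "x \<in> Arr C" "Cod C x = Cod C h" "y \<in> Arr C" "Cod C y = Cod C h" "g \<in> Arr C"
      "Dom C g = Dom C x" "Cod C g = Dom C y" and yg: "y \<cdot> g = x" using that by auto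
    have "y \<cdot> (g \<cdot> pb_fst C x h) = h \<cdot> pb_snd C x h" by (simp add: yg flip: assoc)
    from pb_lift[OF pb _ _ _ _ _ this] 
    show "lift x g y \<in> Arr C" "Dom C (lift x g y) = Dom C (pb_fst C x h)"
      "Cod C (lift x g y) = Dom C (pb_fst C y h)"
      "pb_fst C y h \<cdot> lift x g y = g \<cdot> pb_fst C x h" "pb_snd C y h \<cdot> lift x g y = pb_snd C x h"
      unfolding lift_def by simp_all
  qed
  have FArr: "FArr (pullback_ftr C h) (x, g, y) = (pb_snd C x h, lift x g y, pb_snd C y h)" for x g y
    by (simp add: pullback_ftr_def lift_def)
  have FObj: "FObj (pullback_ftr C h) x = pb_snd C x h" for x
    by (simp add: pullback_ftr_def)
  show ?thesis
  proof
    fix x assume "x \<in> Obj (slice C (Cod C h))"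
    then show "FObj (pullback_ftr C h) x \<in> Obj (slice C (Dom C h))" by (simp add: FObj)
  next
    fix g x y assume "g \<in> Hom (slice C (Cod C h)) x y"
    then show "FArr (pullback_ftr C h) g
        \<in> Hom (slice C (Dom C h)) (FObj (pullback_ftr C h) x) (FObj (pullback_ftr C h) y)"
      by (cases g) (auto simp: Hom_def FObj FArr lift)
  next
    fix x assume x: "x \<in> Obj (slice C (Cod C h))"
    then have "lift x (Ident C (Dom C x)) x = Ident C (Dom C (pb_snd C x h))"
      by - (rule pullback_uniq[OF pb[of x]], simp_all add: lift)
    then show "FArr (pullback_ftr C h) (Ident (slice C (Cod C h)) x)
      = Ident (slice C (Dom C h)) (FObj (pullback_ftr C h) x)"
      by (simp add: FArr FObj)
  next
    fix g k x y z
    assume "g \<in> Hom (slice C (Cod C h)) x y" "k \<in> Hom (slice C (Cod C h)) y z"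
    then obtain g' k' where g: "g = (x, g', y)" "k = (y, k', z)"
      and A: "(x, g', y) \<in> Arr (slice C (Cod C h))" "(y, k', z) \<in> Arr (slice C (Cod C h))"
      by (cases g; cases k) (auto simp: Hom_def)
    have A': "(x, k' \<cdot> g', z) \<in> Arr (slice C (Cod C h))" using A by (simp flip: assoc)
    have [simp]: "x \<in> Arr C" "Cod C x = Cod C h" "y \<in> Arr C" "Cod C y = Cod C h" "g' \<in> Arr C"
      "Dom C g' = Dom C x" "Cod C g' = Dom C y" "z \<in> Arr C" "Cod C z = Cod C h" "k' \<in> Arr C"
      "Dom C k' = Dom C y" "Cod C k' = Dom C z" using A by auto
    note [simp] = lift[OF A(1)] lift[OF A(2)] lift[OF A']
    have "pb_fst C z h \<cdot> (lift y k' z \<cdot> lift x g' y) = (pb_fst C z h \<cdot> lift y k' z) \<cdot> lift x g' y"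
      by (subst assoc) simp_all
    also have "\<dots> = k' \<cdot> (pb_fst C y h \<cdot> lift x g' y)"
      by (simp only: lift[OF A(2)]) (subst assoc, simp_all)
    also have "\<dots> = (k' \<cdot> g') \<cdot> pb_fst C x h" by (simp add: assoc)
    finally have 1: "pb_fst C z h \<cdot> (lift y k' z \<cdot> lift x g' y) = (k' \<cdot> g') \<cdot> pb_fst C x h" .
    have "pb_snd C z h \<cdot> (lift y k' z \<cdot> lift x g' y) = (pb_snd C z h \<cdot> lift y k' z) \<cdot> lift x g' y"
      by (subst assoc) simp_all
    then have 2: "pb_snd C z h \<cdot> (lift y k' z \<cdot> lift x g' y) = pb_snd C x h" by simp
    have "lift x (k' \<cdot> g') z = lift y k' z \<cdot> lift x g' y"
      by (rule pullback_uniq[OF pb[of z]]) (simp_all add: 1 2)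
    then show "FArr (pullback_ftr C h) (k \<cdot>\<^bsub>slice C (Cod C h)\<^esub> g)
      = FArr (pullback_ftr C h) k \<cdot>\<^bsub>slice C (Dom C h)\<^esub> FArr (pullback_ftr C h) g"
      by (simp add: g FArr)
  qed
qed

end

lemma comp_ftr_is_functor:
  assumes "is_functor A B G" "is_functor B C H"
  shows "is_functor A C (H \<circ>\<^sub>F G)"
proof -
  interpret G: is_functor A B G by fact
  interpret H: is_functor B C H by fact
  show ?thesis
    by unfold_locales
      (auto simp: comp_ftr_def G.FArr_Ident H.FArr_Ident G.FArr_Comp
        intro!: H.FArr_in_Hom G.FArr_in_Hom H.FArr_Comp)
qed

locale essential_image_adjunction =
  adjoint_functors F E "essential_image f" "inverse_image f" "ess_unit f" "ess_counit f"
  for F :: "('p, 'b) cat" and E :: "('o, 'a) cat" and f :: "('p, 'b, 'o, 'a) ess_geom_mor"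
begin

lemma transp_eq_flat: "transp E f = flat"
  by (simp add: fun_eq_iff transp_def flat_def)

lemma ess_slice_is_functor:
  assumes [simp]: "e \<in> Obj E"
  shows "is_functor (slice F (FObj (inverse_image f) e)) (slice E e) (ess_slice E f e)"
proof -
  interpret S: category "slice F (FObj (inverse_image f) e)" by (rule C.slice_category)
  interpret T: category "slice E e" by (rule D.slice_category)
  have FObj: "FObj (ess_slice E f e) \<alpha> = flat e \<alpha>" for \<alpha>
    by (simp add: ess_slice_def transp_eq_flat)
  have FArr: "FArr (ess_slice E f e) (\<alpha>, g, \<beta>) = (flat e \<alpha>, FArr (essential_image f) g, flat e \<beta>)"
    for \<alpha> g \<beta> by (simp add: ess_slice_def transp_eq_flat)
  show ?thesis
  proof
    fix g \<alpha> \<beta>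
    assume "g \<in> Hom (slice F (FObj (inverse_image f) e)) \<alpha> \<beta>"
    then show "FArr (ess_slice E f e) g
        \<in> Hom (slice E e) (FObj (ess_slice E f e) \<alpha>) (FObj (ess_slice E f e) \<beta>)"
      by (cases g) (auto simp: Hom_def FObj FArr simp flip: flat_Comp)
  next
    fix g k \<alpha> \<beta> \<gamma>
    assume "g \<in> Hom (slice F (FObj (inverse_image f) e)) \<alpha> \<beta>"
      "k \<in> Hom (slice F (FObj (inverse_image f) e)) \<beta> \<gamma>"
    then show "FArr (ess_slice E f e) (k \<cdot>\<^bsub>slice F (FObj (inverse_image f) e)\<^esub> g)
      = FArr (ess_slice E f e) k \<cdot>\<^bsub>slice E e\<^esub> FArr (ess_slice E f e) g"
      by (cases g; cases k) (auto simp: Hom_def FArr L.FArr_Comp')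
  qed (auto simp: FObj FArr L.FArr_Ident C.Dom_in_Obj)
qed

context
  assumes pbF: "has_pullbacks F" and pbE: "has_pullbacks E"
begin

abbreviation "p\<^sub>F h \<alpha> \<equiv> pb_fst F \<alpha> (FArr (inverse_image f) h)"
abbreviation "q\<^sub>F h \<alpha> \<equiv> pb_snd F \<alpha> (FArr (inverse_image f) h)"
abbreviation "p\<^sub>E h \<alpha> \<equiv> pb_fst E (flat (Cod E h) \<alpha>) h"
abbreviation "q\<^sub>E h \<alpha> \<equiv> pb_snd E (flat (Cod E h) \<alpha>) h"

text \<open>The arrow of \<open>E\<close> that underlies the component of the comparison at \<open>\<alpha>\<close>.\<close>

definition cmp_arr where
  "cmp_arr h \<alpha> = pb_lift E (flat (Cod E h) \<alpha>) h (FArr (essential_image f) (p\<^sub>F h \<alpha>))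
     (flat (Dom E h) (q\<^sub>F h \<alpha>))"

lemma comparison_eq: "comparison F E f h \<alpha> = (flat (Dom E h) (q\<^sub>F h \<alpha>), cmp_arr h \<alpha>, q\<^sub>E h \<alpha>)"
  by (simp add: comparison_def Let_def transp_eq_flat cmp_arr_def)

context
  fixes h assumes h [simp]: "h \<in> Arr E"
begin

lemma pullback_F:
  "\<lbrakk>\<alpha> \<in> Arr F; Cod F \<alpha> = FObj (inverse_image f) (Cod E h)\<rbrakk>
    \<Longrightarrow> is_pullback F \<alpha> (FArr (inverse_image f) h) (p\<^sub>F h \<alpha>) (q\<^sub>F h \<alpha>)"
  by (rule C.pb_is_pullback[OF pbF]) simp_all

lemma pullback_E:
  "\<lbrakk>\<alpha> \<in> Arr F; Cod F \<alpha> = FObj (inverse_image f) (Cod E h)\<rbrakk>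
    \<Longrightarrow> is_pullback E (flat (Cod E h) \<alpha>) h (p\<^sub>E h \<alpha>) (q\<^sub>E h \<alpha>)"
  by (rule D.pb_is_pullback[OF pbE]) (simp_all add: D.Cod_in_Obj)

context
  fixes \<alpha>
  assumes \<alpha> [simp]: "\<alpha> \<in> Arr F" "Cod F \<alpha> = FObj (inverse_image f) (Cod E h)"
begin

lemma projections_F [simp]:
  "p\<^sub>F h \<alpha> \<in> Arr F" "q\<^sub>F h \<alpha> \<in> Arr F" "Dom F (q\<^sub>F h \<alpha>) = Dom F (p\<^sub>F h \<alpha>)"
  "Cod F (p\<^sub>F h \<alpha>) = Dom F \<alpha>" "Cod F (q\<^sub>F h \<alpha>) = FObj (inverse_image f) (Dom E h)"
  using C.pullbackD[OF pullback_F[OF \<alpha>]] by simp_all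

lemma projections_E [simp]:
  "p\<^sub>E h \<alpha> \<in> Arr E" "q\<^sub>E h \<alpha> \<in> Arr E" "Dom E (q\<^sub>E h \<alpha>) = Dom E (p\<^sub>E h \<alpha>)"
  "Cod E (p\<^sub>E h \<alpha>) = FObj (essential_image f) (Dom F \<alpha>)" "Cod E (q\<^sub>E h \<alpha>) = Dom E h"
  using D.pullbackD[OF pullback_E[OF \<alpha>]] by (simp_all add: D.Cod_in_Obj)

lemma cmp_arr:
  "cmp_arr h \<alpha> \<in> Arr E" "Dom E (cmp_arr h \<alpha>) = FObj (essential_image f) (Dom F (p\<^sub>F h \<alpha>))"
  "Cod E (cmp_arr h \<alpha>) = Dom E (p\<^sub>E h \<alpha>)"
  "p\<^sub>E h \<alpha> \<cdot>\<^bsub>E\<^esub> cmp_arr h \<alpha> = FArr (essential_image f) (p\<^sub>F h \<alpha>)"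
  "q\<^sub>E h \<alpha> \<cdot>\<^bsub>E\<^esub> cmp_arr h \<alpha> = flat (Dom E h) (q\<^sub>F h \<alpha>)"
proof -
  note [simp] = D.Dom_in_Obj D.Cod_in_Obj
  have "flat (Cod E h) (\<alpha> \<cdot>\<^bsub>F\<^esub> p\<^sub>F h \<alpha>) = flat (Cod E h) (FArr (inverse_image f) h \<cdot>\<^bsub>F\<^esub> q\<^sub>F h \<alpha>)"
    using C.pullbackD(9)[OF pullback_F[OF \<alpha>]] by simp
  then have "flat (Cod E h) \<alpha> \<cdot>\<^bsub>E\<^esub> FArr (essential_image f) (p\<^sub>F h \<alpha>)
      = h \<cdot>\<^bsub>E\<^esub> flat (Dom E h) (q\<^sub>F h \<alpha>)"
    by (simp add: flat_Comp[where \<alpha> = \<alpha>] flat_FArr_Comp)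
  from D.pb_lift[OF pullback_E[OF \<alpha>] _ _ _ _ _ this]
  show "cmp_arr h \<alpha> \<in> Arr E" "Dom E (cmp_arr h \<alpha>) = FObj (essential_image f) (Dom F (p\<^sub>F h \<alpha>))"
    "Cod E (cmp_arr h \<alpha>) = Dom E (p\<^sub>E h \<alpha>)"
    "p\<^sub>E h \<alpha> \<cdot>\<^bsub>E\<^esub> cmp_arr h \<alpha> = FArr (essential_image f) (p\<^sub>F h \<alpha>)"
    "q\<^sub>E h \<alpha> \<cdot>\<^bsub>E\<^esub> cmp_arr h \<alpha> = flat (Dom E h) (q\<^sub>F h \<alpha>)"
    unfolding cmp_arr_def by simp_all
qed

lemma comparison_iso_iff:
  "iso_arr (slice E (Dom E h)) (comparison F E f h \<alpha>) \<longleftrightarrow> iso_arr E (cmp_arr h \<alpha>)"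
  unfolding comparison_eq by (rule D.slice_iso_iff) (simp add: cmp_arr D.Dom_in_Obj)

end

text \<open>The comparison is natural because both legs of the naturality square have the same
  composites with the two projections of a pullback.\<close>

lemma comparison_natural:
  "nat_trans (slice F (FObj (inverse_image f) (Cod E h))) (slice E (Dom E h))
     (ess_slice E f (Dom E h) \<circ>\<^sub>F pullback_ftr F (FArr (inverse_image f) h))
     (pullback_ftr E h \<circ>\<^sub>F ess_slice E f (Cod E h))
     (comparison F E f h)" (is "nat_trans ?S ?T ?G ?H _")
  unfolding nat_trans_def
proof (intro conjI ballI)
  note [simp] = D.Dom_in_Obj D.Cod_in_Obj C.Dom_in_Obj
  have "is_functor ?S (slice F (FObj (inverse_image f) (Dom E h)))
      (pullback_ftr F (FArr (inverse_image f) h))"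
    using C.pullback_ftr_is_functor[OF pbF, of "FArr (inverse_image f) h"] by simp
  then show "is_functor ?S ?T ?G"
    by (rule comp_ftr_is_functor) (rule ess_slice_is_functor, simp)
  show "is_functor ?S ?T ?H"
    by (rule comp_ftr_is_functor[OF ess_slice_is_functor D.pullback_ftr_is_functor]) (simp_all add: pbE)
  have G: "FObj ?G \<alpha> = flat (Dom E h) (q\<^sub>F h \<alpha>)" and H: "FObj ?H \<alpha> = q\<^sub>E h \<alpha>" for \<alpha>
    by (simp_all add: comp_ftr_def pullback_ftr_def ess_slice_def transp_eq_flat)
  {
    fix \<alpha> assume "\<alpha> \<in> Obj ?S"
    then show "comparison F E f h \<alpha> \<in> Hom ?T (FObj ?G \<alpha>) (FObj ?H \<alpha>)"
      by (simp add: Hom_def comparison_eq G H cmp_arr)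
  }
  fix t assume "t \<in> Arr ?S"
  then obtain \<alpha> g \<beta> where t: "t = (\<alpha>, g, \<beta>)"
    and [simp]: "\<alpha> \<in> Arr F" "Cod F \<alpha> = FObj (inverse_image f) (Cod E h)"
      "\<beta> \<in> Arr F" "Cod F \<beta> = FObj (inverse_image f) (Cod E h)"
      "g \<in> Arr F" "Dom F g = Dom F \<alpha>" "Cod F g = Dom F \<beta>"
    and \<beta>g: "\<beta> \<cdot>\<^bsub>F\<^esub> g = \<alpha>" by (cases t) simp
  note [simp] = cmp_arr
  let ?L = "FArr (essential_image f)"
  define m where "m = pb_lift F \<beta> (FArr (inverse_image f) h) (g \<cdot>\<^bsub>F\<^esub> p\<^sub>F h \<alpha>) (q\<^sub>F h \<alpha>)"
  have "\<beta> \<cdot>\<^bsub>F\<^esub> (g \<cdot>\<^bsub>F\<^esub> p\<^sub>F h \<alpha>) = FArr (inverse_image f) h \<cdot>\<^bsub>F\<^esub> q\<^sub>F h \<alpha>"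
    using C.pullbackD(9)[OF pullback_F[of \<alpha>]] by (simp add: \<beta>g flip: C.assoc)
  from C.pb_lift[OF pullback_F[of \<beta>] _ _ _ _ _ this]
  have m [simp]: "m \<in> Arr F" "Dom F m = Dom F (p\<^sub>F h \<alpha>)" "Cod F m = Dom F (p\<^sub>F h \<beta>)"
    and pm: "p\<^sub>F h \<beta> \<cdot>\<^bsub>F\<^esub> m = g \<cdot>\<^bsub>F\<^esub> p\<^sub>F h \<alpha>" and qm: "q\<^sub>F h \<beta> \<cdot>\<^bsub>F\<^esub> m = q\<^sub>F h \<alpha>"
    unfolding m_def by simp_all
  define n where "n = pb_lift E (flat (Cod E h) \<beta>) h (?L g \<cdot>\<^bsub>E\<^esub> p\<^sub>E h \<alpha>) (q\<^sub>E h \<alpha>)"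
  have "flat (Cod E h) \<beta> \<cdot>\<^bsub>E\<^esub> (?L g \<cdot>\<^bsub>E\<^esub> p\<^sub>E h \<alpha>) = h \<cdot>\<^bsub>E\<^esub> q\<^sub>E h \<alpha>"
    using D.pullbackD(9)[OF pullback_E[of \<alpha>]]
    by (simp add: \<beta>g flip: D.assoc flat_Comp)
  from D.pb_lift[OF pullback_E[of \<beta>] _ _ _ _ _ this]
  have n [simp]: "n \<in> Arr E" "Dom E n = Dom E (p\<^sub>E h \<alpha>)" "Cod E n = Dom E (p\<^sub>E h \<beta>)"
    and pn: "p\<^sub>E h \<beta> \<cdot>\<^bsub>E\<^esub> n = ?L g \<cdot>\<^bsub>E\<^esub> p\<^sub>E h \<alpha>" and qn: "q\<^sub>E h \<beta> \<cdot>\<^bsub>E\<^esub> n = q\<^sub>E h \<alpha>"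
    unfolding n_def by simp_all
  have "p\<^sub>E h \<beta> \<cdot>\<^bsub>E\<^esub> (cmp_arr h \<beta> \<cdot>\<^bsub>E\<^esub> ?L m) = ?L (p\<^sub>F h \<beta> \<cdot>\<^bsub>F\<^esub> m)"
    by (simp add: L.FArr_Comp' flip: D.assoc)
  also have "\<dots> = (p\<^sub>E h \<beta> \<cdot>\<^bsub>E\<^esub> n) \<cdot>\<^bsub>E\<^esub> cmp_arr h \<alpha>"
    by (simp add: pm pn L.FArr_Comp' D.assoc)
  finally have 1: "p\<^sub>E h \<beta> \<cdot>\<^bsub>E\<^esub> (cmp_arr h \<beta> \<cdot>\<^bsub>E\<^esub> ?L m) = p\<^sub>E h \<beta> \<cdot>\<^bsub>E\<^esub> (n \<cdot>\<^bsub>E\<^esub> cmp_arr h \<alpha>)"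
    by (simp add: D.assoc)
  have "q\<^sub>E h \<beta> \<cdot>\<^bsub>E\<^esub> (cmp_arr h \<beta> \<cdot>\<^bsub>E\<^esub> ?L m) = flat (Dom E h) (q\<^sub>F h \<beta> \<cdot>\<^bsub>F\<^esub> m)"
    by (simp add: flat_Comp flip: D.assoc)
  also have "\<dots> = (q\<^sub>E h \<beta> \<cdot>\<^bsub>E\<^esub> n) \<cdot>\<^bsub>E\<^esub> cmp_arr h \<alpha>"
    by (simp add: qm qn)
  finally have 2: "q\<^sub>E h \<beta> \<cdot>\<^bsub>E\<^esub> (cmp_arr h \<beta> \<cdot>\<^bsub>E\<^esub> ?L m) = q\<^sub>E h \<beta> \<cdot>\<^bsub>E\<^esub> (n \<cdot>\<^bsub>E\<^esub> cmp_arr h \<alpha>)"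
    by (simp add: D.assoc)
  have "cmp_arr h \<beta> \<cdot>\<^bsub>E\<^esub> ?L m = n \<cdot>\<^bsub>E\<^esub> cmp_arr h \<alpha>"
    by (rule D.pullback_uniq[OF pullback_E[of \<beta>] _ _ _ _ _ 1 2]) simp_all
  moreover have "FArr ?G t = (flat (Dom E h) (q\<^sub>F h \<alpha>), ?L m, flat (Dom E h) (q\<^sub>F h \<beta>))"
    by (simp add: t comp_ftr_def pullback_ftr_def ess_slice_def transp_eq_flat m_def)
  moreover have "FArr ?H t = (q\<^sub>E h \<alpha>, n, q\<^sub>E h \<beta>)"
    by (simp add: t comp_ftr_def pullback_ftr_def ess_slice_def transp_eq_flat n_def)
  ultimately show "comparison F E f h (Cod ?S t) \<cdot>\<^bsub>?T\<^esub> FArr ?G t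
      = FArr ?H t \<cdot>\<^bsub>?T\<^esub> comparison F E f h (Dom ?S t)"
    by (simp add: t comparison_eq)
qed

end

text \<open>The underlying arrow of the comparison at \<open>\<alpha>\<close> is the one from the transposed square to the
  pullback in \<open>E\<close>; it is invertible precisely when the transposed square is a pullback.\<close>

lemma locally_connected_iff_transposes_pullbacks:
  "locally_connected F E f \<longleftrightarrow> transposes_pullbacks"
proof
  note [simp] = D.Dom_in_Obj D.Cod_in_Obj
  assume lc: "locally_connected F E f"
  show transposes_pullbacks unfolding transposes_pullbacks_def
  proof (intro ballI allI impI)
    fix h \<alpha> p q
    assume h [simp]: "h \<in> Arr E" and pb: "is_pullback F \<alpha> (FArr (inverse_image f) h) p q"
    have \<alpha> [simp]: "\<alpha> \<in> Arr F" "Cod F \<alpha> = FObj (inverse_image f) (Cod E h)"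
      using C.pullbackD[OF pb] by auto
    have "iso_arr E (cmp_arr h \<alpha>)"
      using lc comparison_iso_iff[OF h \<alpha>] by (simp add: locally_connected_def nat_iso_def)
    moreover obtain i where i: "iso_arr F i" and [simp]: "Cod F i = Dom F (p\<^sub>F h \<alpha>)"
      and pi: "p\<^sub>F h \<alpha> \<cdot>\<^bsub>F\<^esub> i = p" and qi: "q\<^sub>F h \<alpha> \<cdot>\<^bsub>F\<^esub> i = q"
      using C.pullbacks_isoE[OF pullback_F[OF h \<alpha>] pb] by blast
    moreover note [simp] = C.iso_in_Arr[OF i] cmp_arr[OF h \<alpha>] projections_F[OF h \<alpha>]
      projections_E[OF h \<alpha>]
    ultimately have "is_pullback E (flat (Cod E h) \<alpha>) h
        (p\<^sub>E h \<alpha> \<cdot>\<^bsub>E\<^esub> (cmp_arr h \<alpha> \<cdot>\<^bsub>E\<^esub> FArr (essential_image f) i))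
        (q\<^sub>E h \<alpha> \<cdot>\<^bsub>E\<^esub> (cmp_arr h \<alpha> \<cdot>\<^bsub>E\<^esub> FArr (essential_image f) i))"
      by (intro D.pullback_Comp_iso[OF pullback_E[OF h \<alpha>]] D.iso_Comp L.FArr_iso) simp_all
    moreover have "p\<^sub>E h \<alpha> \<cdot>\<^bsub>E\<^esub> (cmp_arr h \<alpha> \<cdot>\<^bsub>E\<^esub> FArr (essential_image f) i) = FArr (essential_image f) p"
      by (simp add: L.FArr_Comp' flip: D.assoc pi)
    moreover have "q\<^sub>E h \<alpha> \<cdot>\<^bsub>E\<^esub> (cmp_arr h \<alpha> \<cdot>\<^bsub>E\<^esub> FArr (essential_image f) i) = flat (Dom E h) q"
      by (simp add: flat_Comp flip: D.assoc qi)
    ultimately show "is_pullback E (flat (Cod E h) \<alpha>) h (FArr (essential_image f) p) (flat (Dom E h) q)"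
      by simp
  qed
next
  assume tp: transposes_pullbacks
  show "locally_connected F E f" unfolding locally_connected_def nat_iso_def
  proof (intro ballI conjI comparison_natural)
    fix h \<alpha>
    assume h: "h \<in> Arr E" and "\<alpha> \<in> Obj (slice F (FObj (inverse_image f) (Cod E h)))"
    then have \<alpha>: "\<alpha> \<in> Arr F" "Cod F \<alpha> = FObj (inverse_image f) (Cod E h)" by simp_all
    have "is_pullback E (flat (Cod E h) \<alpha>) h (FArr (essential_image f) (p\<^sub>F h \<alpha>))
        (flat (Dom E h) (q\<^sub>F h \<alpha>))"
      using tp pullback_F[OF h \<alpha>] h unfolding transposes_pullbacks_def by blast
    then have "iso_arr E (cmp_arr h \<alpha>)"
      by (rule D.pullback_comparison_iso[OF pullback_E[OF h \<alpha>]])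
        (simp_all add: cmp_arr[OF h \<alpha>] projections_F[OF h \<alpha>])
    then show "iso_arr (slice E (Dom E h)) (comparison F E f h \<alpha>)"
      by (simp add: comparison_iso_iff[OF h \<alpha>])
  qed
qed

end

lemma locally_connected_iff_fibration:
  assumes "has_pullbacks F" "has_pullbacks E"
  shows "locally_connected F E f \<longleftrightarrow> street_fibration F E (essential_image f)"
  using assms locally_connected_iff_transposes_pullbacks fibration_if_transposes_pullbacks
    transposes_pullbacks_if_fibration by blast

end


section \<open>Transfer of pullbacks along an equivalence\<close>

text \<open>By essential surjectivity the vertex of a pullback in \<open>D\<close> may be taken in the image of the
  functor; fullness lifts its projections to \<open>C\<close>, and a fully faithful functor reflects universal
  properties.\<close>

lemma (in is_functor) has_pullbacks_reflect:
  assumes faithful: "\<And>f g. \<lbrakk>f \<in> Arr C; g \<in> Arr C; Dom C f = Dom C g; Cod C f = Cod C g;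
      FArr F f = FArr F g\<rbrakk> \<Longrightarrow> f = g"
    and full: "\<And>a b h. \<lbrakk>a \<in> Obj C; b \<in> Obj C; h \<in> Arr D; Dom D h = FObj F a; Cod D h = FObj F b\<rbrakk>
      \<Longrightarrow> \<exists>k \<in> Arr C. Dom C k = a \<and> Cod C k = b \<and> FArr F k = h"
    and ess_surj: "\<And>d. d \<in> Obj D \<Longrightarrow> \<exists>a \<in> Obj C. \<exists>i. iso_arr D i \<and> Dom D i = FObj F a \<and> Cod D i = d"
    and pbs: "has_pullbacks D"
  shows "has_pullbacks C"
  unfolding has_pullbacks_def
proof (intro ballI impI)
  note [simp] = C.Dom_in_Obj C.Cod_in_Obj D.Dom_in_Obj D.Cod_in_Obj
  fix f g assume [simp]: "f \<in> Arr C" "g \<in> Arr C" "Cod C f = Cod C g"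
  obtain p' q' where pb': "is_pullback D (FArr F f) (FArr F g) p' q'"
    by (rule has_pullbacksE[OF pbs, of "FArr F f" "FArr F g"]) simp_all
  note [simp] = D.pullbackD(3,4,6)[OF pb']
  have [simp]: "Cod D p' = FObj F (Dom C f)" "Cod D q' = FObj F (Dom C g)"
    using D.pullbackD[OF pb'] by simp_all
  obtain a i where [simp]: "a \<in> Obj C" and i: "iso_arr D i"
    and [simp]: "Dom D i = FObj F a" "Cod D i = Dom D p'"
    using ess_surj[of "Dom D p'"] by auto
  note [simp] = D.iso_in_Arr[OF i]
  obtain p where p [simp]: "p \<in> Arr C" "Dom C p = a" "Cod C p = Dom C f" "FArr F p = p' \<cdot>\<^bsub>D\<^esub> i"
    using full[of a "Dom C f" "p' \<cdot>\<^bsub>D\<^esub> i"] by auto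
  obtain q where q [simp]: "q \<in> Arr C" "Dom C q = a" "Cod C q = Dom C g" "FArr F q = q' \<cdot>\<^bsub>D\<^esub> i"
    using full[of a "Dom C g" "q' \<cdot>\<^bsub>D\<^esub> i"] by auto
  have pb: "is_pullback D (FArr F f) (FArr F g) (FArr F p) (FArr F q)"
    using D.pullback_Comp_iso[OF pb' i] by simp
  have "is_pullback C f g p q"
  proof (rule C.pullbackI)
    show "f \<cdot>\<^bsub>C\<^esub> p = g \<cdot>\<^bsub>C\<^esub> q"
      by (rule faithful) (use D.pullbackD(9)[OF pb] in \<open>simp_all add: FArr_Comp'\<close>)
  next
    fix x y
    assume xy [simp]: "x \<in> Arr C" "y \<in> Arr C" "Dom C x = Dom C y" "Cod C x = Dom C f"
      "Cod C y = Dom C g" and eq: "f \<cdot>\<^bsub>C\<^esub> x = g \<cdot>\<^bsub>C\<^esub> y"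
    have "FArr F (f \<cdot>\<^bsub>C\<^esub> x) = FArr F (g \<cdot>\<^bsub>C\<^esub> y)" by (simp add: eq)
    then have eq': "FArr F f \<cdot>\<^bsub>D\<^esub> FArr F x = FArr F g \<cdot>\<^bsub>D\<^esub> FArr F y" by (simp add: FArr_Comp')
    obtain k' where "k' \<in> Arr D" "Dom D k' = FObj F (Dom C y)" "Cod D k' = FObj F a"
      and k': "FArr F p \<cdot>\<^bsub>D\<^esub> k' = FArr F x" "FArr F q \<cdot>\<^bsub>D\<^esub> k' = FArr F y"
      by (rule D.pullback_liftE[OF pb _ _ _ _ _ eq']) simp_all
    then obtain k where [simp]: "k \<in> Arr C" "Dom C k = Dom C y" "Cod C k = a" and "FArr F k = k'"
      using full[of "Dom C y" a k'] by auto
    with k' have "FArr F (p \<cdot>\<^bsub>C\<^esub> k) = FArr F x" "FArr F (q \<cdot>\<^bsub>C\<^esub> k) = FArr F y"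
      by (simp_all add: FArr_Comp' del: p(4) q(4))
    then have "p \<cdot>\<^bsub>C\<^esub> k = x" "q \<cdot>\<^bsub>C\<^esub> k = y" by (auto intro: faithful)
    then show "\<exists>k\<in>Arr C. Dom C k = Dom C y \<and> Cod C k = Dom C p \<and> p \<cdot>\<^bsub>C\<^esub> k = x \<and> q \<cdot>\<^bsub>C\<^esub> k = y"
      by (intro bexI[of _ k]) simp_all
  next
    fix k l
    assume [simp]: "k \<in> Arr C" "l \<in> Arr C" "Dom C k = Dom C l" "Cod C k = Dom C p"
      "Cod C l = Dom C p" and eq: "p \<cdot>\<^bsub>C\<^esub> k = p \<cdot>\<^bsub>C\<^esub> l" "q \<cdot>\<^bsub>C\<^esub> k = q \<cdot>\<^bsub>C\<^esub> l"
    have "FArr F (p \<cdot>\<^bsub>C\<^esub> k) = FArr F (p \<cdot>\<^bsub>C\<^esub> l)" "FArr F (q \<cdot>\<^bsub>C\<^esub> k) = FArr F (q \<cdot>\<^bsub>C\<^esub> l)"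
      by (simp_all only: eq)
    then have "FArr F k = FArr F l"
      by - (rule D.pullback_uniq[OF pb], simp_all add: FArr_Comp' del: p(4) q(4))
    then show "k = l" by (rule faithful[rotated -1]) simp_all
  qed simp_all
  then show "\<exists>p q. is_pullback C f g p q" by blast
qed

text \<open>An equivalence is fully faithful: each of the two natural isomorphisms makes one of the functors
  faithful, and fullness of \<open>F\<close> follows from that of \<open>G F\<close>, which is isomorphic to the identity,
  because \<open>G\<close> is faithful.\<close>

lemma has_pullbacks_equivalent:
  assumes "equivalent_cats A B" and pbs: "has_pullbacks B"
  shows "has_pullbacks A"
proof -
  obtain F G \<eta> \<epsilon> where "is_functor A B F" "is_functor B A G"
    and \<eta>: "nat_iso A A id_ftr (G \<circ>\<^sub>F F) \<eta>" and \<epsilon>: "nat_iso B B (F \<circ>\<^sub>F G) id_ftr \<epsilon>"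
    using assms(1) unfolding equivalent_cats_def by blast
  interpret F: is_functor A B F by fact
  interpret G: is_functor B A G by fact
  note [simp] = F.C.Dom_in_Obj F.C.Cod_in_Obj F.D.Dom_in_Obj F.D.Cod_in_Obj
  have [simp]: "\<eta> a \<in> Arr A" "Dom A (\<eta> a) = a" "Cod A (\<eta> a) = FObj G (FObj F a)"
    and \<eta>_iso: "iso_arr A (\<eta> a)" if "a \<in> Obj A" for a
    using \<eta> that by (auto simp: nat_iso_def nat_trans_def comp_ftr_def id_ftr_def Hom_def)
  have \<eta>_nat: "\<eta> (Cod A f) \<cdot>\<^bsub>A\<^esub> f = FArr G (FArr F f) \<cdot>\<^bsub>A\<^esub> \<eta> (Dom A f)" if "f \<in> Arr A" for f
    using \<eta> that by (auto simp: nat_iso_def nat_trans_def comp_ftr_def id_ftr_def)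
  have [simp]: "\<epsilon> b \<in> Arr B" "Dom B (\<epsilon> b) = FObj F (FObj G b)" "Cod B (\<epsilon> b) = b"
    and \<epsilon>_iso: "iso_arr B (\<epsilon> b)" if "b \<in> Obj B" for b
    using \<epsilon> that by (auto simp: nat_iso_def nat_trans_def comp_ftr_def id_ftr_def Hom_def)
  have \<epsilon>_nat: "\<epsilon> (Cod B f) \<cdot>\<^bsub>B\<^esub> FArr F (FArr G f) = f \<cdot>\<^bsub>B\<^esub> \<epsilon> (Dom B f)" if "f \<in> Arr B" for f
    using \<epsilon> that by (auto simp: nat_iso_def nat_trans_def comp_ftr_def id_ftr_def)
  have faithful_F: "f = g" if [simp]: "f \<in> Arr A" "g \<in> Arr A" "Dom A f = Dom A g" "Cod A f = Cod A g"
    and eq: "FArr F f = FArr F g" for f g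
  proof (rule F.C.iso_mono)
    show "iso_arr A (\<eta> (Cod A g))" by (rule \<eta>_iso) simp
    show "\<eta> (Cod A g) \<cdot>\<^bsub>A\<^esub> f = \<eta> (Cod A g) \<cdot>\<^bsub>A\<^esub> g"
      using \<eta>_nat[of f] \<eta>_nat[of g] by (simp add: eq)
  qed simp_all
  have faithful_G: "f = g" if [simp]: "f \<in> Arr B" "g \<in> Arr B" "Dom B f = Dom B g" "Cod B f = Cod B g"
    and eq: "FArr G f = FArr G g" for f g
  proof (rule F.D.iso_epi)
    show "iso_arr B (\<epsilon> (Dom B g))" by (rule \<epsilon>_iso) simp
    show "f \<cdot>\<^bsub>B\<^esub> \<epsilon> (Dom B g) = g \<cdot>\<^bsub>B\<^esub> \<epsilon> (Dom B g)"
      using \<epsilon>_nat[of f] \<epsilon>_nat[of g] by (simp add: eq)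
  qed simp_all
  show ?thesis
  proof (rule F.has_pullbacks_reflect[OF faithful_F _ _ pbs])
    fix a b h
    assume [simp]: "a \<in> Obj A" "b \<in> Obj A" "h \<in> Arr B" "Dom B h = FObj F a" "Cod B h = FObj F b"
    obtain n where [simp]: "n \<in> Arr A" "Dom A n = FObj G (FObj F b)" "Cod A n = b"
      and n: "\<eta> b \<cdot>\<^bsub>A\<^esub> n = Ident A (FObj G (FObj F b))"
      using F.C.isoE[OF \<eta>_iso[of b]] by auto
    define k where "k = n \<cdot>\<^bsub>A\<^esub> (FArr G h \<cdot>\<^bsub>A\<^esub> \<eta> a)"
    have [simp]: "k \<in> Arr A" "Dom A k = a" "Cod A k = b" by (simp_all add: k_def)
    have "\<eta> b \<cdot>\<^bsub>A\<^esub> k = FArr G h \<cdot>\<^bsub>A\<^esub> \<eta> a"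
      by (simp add: k_def n flip: F.C.assoc)
    with \<eta>_nat[of k] have "FArr G (FArr F k) \<cdot>\<^bsub>A\<^esub> \<eta> a = FArr G h \<cdot>\<^bsub>A\<^esub> \<eta> a" by simp
    then have "FArr G (FArr F k) = FArr G h"
      by (rule F.C.iso_epi[rotated -1]) (simp_all add: \<eta>_iso)
    then have "FArr F k = h" by (rule faithful_G[rotated -1]) simp_all
    then show "\<exists>k\<in>Arr A. Dom A k = a \<and> Cod A k = b \<and> FArr F k = h"
      by (intro bexI[of _ k]) simp_all
  next
    fix b assume [simp]: "b \<in> Obj B"
    show "\<exists>a\<in>Obj A. \<exists>i. iso_arr B i \<and> Dom B i = FObj F a \<and> Cod B i = b"
      by (intro bexI[of _ "FObj G b"] exI[of _ "\<epsilon> b"]) (simp_all add: \<epsilon>_iso)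
  qed
qed


section \<open>Pullbacks of sheaves\<close>

text \<open>Sections of a fibre product are pairs, but they have to be elements of \<open>'u\<close>; they are therefore
  coded by an injection \<open>e : 'u \<times> 'u \<rightarrow> 'u\<close>, which exists because \<open>'u\<close> is infinite.  Regularity of the
  universe bounds the size of the coded product.\<close>

lemma small_image_Times:
  fixes A B :: "'u::universe set" and e :: "'u \<times> 'u \<Rightarrow> 'u"
  assumes "small A" "small B"
  shows "small (e ` (A \<times> B))"
proof -
  have "e ` (A \<times> B) = (\<Union>a \<in> A. (\<lambda>b. e (a, b)) ` B)" by auto
  moreover have "(\<lambda>b. e (a, b)) ` B \<prec> (UNIV :: 'u set)" for a
    by (rule lesspoll_trans1[OF image_lepoll assms(2)[unfolded small_def]])
  ultimately show ?thesis
    using universe_Union[of A "\<lambda>a. (\<lambda>b. e (a, b)) ` B"] assms(1) by (simp add: small_def)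
qed

lemma pairing_exists: "\<exists>e :: 'u::universe \<times> 'u \<Rightarrow> 'u. inj e"
  using card_of_Times_same_infinite[OF universe_infinite[where 'a='u]]
  by (auto simp: bij_betw_def simp flip: card_of_ordIso)

lemma sheaf_cat_simps [simp]:
  "Obj (sheaf_cat C J) = {P. sheaf C J P}"
  "Arr (sheaf_cat C J) = sheaf_arrows C J"
  "Dom (sheaf_cat C J) (P, \<theta>, Q) = P"
  "Cod (sheaf_cat C J) (P, \<theta>, Q) = Q"
  "Comp (sheaf_cat C J) (Q', \<phi>, R) (P, \<theta>, Q) = (P, \<lambda>c \<in> Obj C. compose (Sec P c) (\<phi> c) (\<theta> c), R)"
  by (simp_all add: sheaf_cat_def)

lemma sheaf_arrow_iff:
  "(P, \<theta>, Q) \<in> sheaf_arrows C J \<longleftrightarrow> sheaf C J P \<and> sheaf C J Q \<and> \<theta> \<in> extensional (Obj C) \<and>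
     (\<forall>c \<in> Obj C. \<theta> c \<in> extensional (Sec P c) \<and> (\<forall>x \<in> Sec P c. \<theta> c x \<in> Sec Q c)) \<and>
     (\<forall>f \<in> Arr C. \<forall>x \<in> Sec P (Cod C f). \<theta> (Dom C f) (Res P f x) = Res Q f (\<theta> (Cod C f) x))"
  by (auto simp: sheaf_arrows_def PiE_def Pi_def)

lemma sheaf_arrow_eqI:
  assumes "(P, \<theta>, Q) \<in> sheaf_arrows C J" "(P, \<theta>', Q) \<in> sheaf_arrows C J"
    and "\<And>c x. \<lbrakk>c \<in> Obj C; x \<in> Sec P c\<rbrakk> \<Longrightarrow> \<theta> c x = \<theta>' c x"
  shows "\<theta> = \<theta>'"
proof (rule extensionalityI[of _ "Obj C"])
  fix c assume "c \<in> Obj C"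
  with assms show "\<theta> c = \<theta>' c"
    by (intro extensionalityI[of _ "Sec P c"]) (auto simp: sheaf_arrow_iff)
qed (use assms in \<open>simp_all add: sheaf_arrow_iff\<close>)

definition fibre_product ::
  "('u \<times> 'u \<Rightarrow> 'u) \<Rightarrow> ('o, 'a, 'u::universe) psh \<Rightarrow> ('o \<Rightarrow> 'u \<Rightarrow> 'u)
    \<Rightarrow> ('o, 'a, 'u) psh \<Rightarrow> ('o \<Rightarrow> 'u \<Rightarrow> 'u) \<Rightarrow> ('o, 'a, 'u) psh" where
  "fibre_product e P \<theta> Q \<phi> =
     \<lparr>Sec = (\<lambda>c. e ` {(x, y). x \<in> Sec P c \<and> y \<in> Sec Q c \<and> \<theta> c x = \<phi> c y}),
      Res = (\<lambda>f z. e (Res P f (fst (inv e z)), Res Q f (snd (inv e z))))\<rparr>"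

context category
begin

context
  fixes J :: "'o \<Rightarrow> 'a set set" and e :: "'u::universe \<times> 'u \<Rightarrow> 'u"
    and P Q R :: "('o, 'a, 'u) psh" and \<theta> \<phi>
  assumes J: "grothendieck_topology C J" and e: "inj e"
    and \<theta>: "(P, \<theta>, R) \<in> sheaf_arrows C J" and \<phi>: "(Q, \<phi>, R) \<in> sheaf_arrows C J"
begin

abbreviation "PQ \<equiv> fibre_product e P \<theta> Q \<phi>"

lemma inv_pairing [simp]: "inv e (e z) = z"
  by (rule inv_f_f[OF e])

lemma Sec_fibre_product:
  "z \<in> Sec PQ c \<longleftrightarrow> (\<exists>x y. z = e (x, y) \<and> x \<in> Sec P c \<and> y \<in> Sec Q c \<and> \<theta> c x = \<phi> c y)"
  by (auto simp: fibre_product_def)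

lemma Res_fibre_product [simp]: "Res PQ f (e (x, y)) = e (Res P f x, Res Q f y)"
  by (simp add: fibre_product_def)

lemma e_eq_iff [simp]: "e z = e w \<longleftrightarrow> z = w"
  using e by (auto dest: injD)

lemma presheaf_fibre_product: "presheaf C PQ"
proof -
  have P: "presheaf C P" and Q: "presheaf C Q" using \<theta> \<phi> by (auto simp: sheaf_arrow_iff sheaf_def)
  show ?thesis unfolding presheaf_def
  proof (intro conjI ballI impI)
    fix c assume "c \<in> Obj C"
    then have "small (e ` (Sec P c \<times> Sec Q c))"
      using P Q by (intro small_image_Times) (auto simp: presheaf_def)
    moreover have "Sec PQ c \<subseteq> e ` (Sec P c \<times> Sec Q c)" by (auto simp: Sec_fibre_product)
    ultimately show "small (Sec PQ c)"
      unfolding small_def by (meson lesspoll_trans1 subset_imp_lepoll)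
  next
    fix f assume f: "f \<in> Arr C"
    with P Q have "Res P f \<in> Sec P (Cod C f) \<rightarrow> Sec P (Dom C f)"
      "Res Q f \<in> Sec Q (Cod C f) \<rightarrow> Sec Q (Dom C f)" by (auto simp: presheaf_def)
    with f \<theta> \<phi> show "Res PQ f \<in> Sec PQ (Cod C f) \<rightarrow> Sec PQ (Dom C f)"
      by (fastforce simp: Sec_fibre_product sheaf_arrow_iff)
  next
    fix c x assume "c \<in> Obj C" "x \<in> Sec PQ c"
    with P Q show "Res PQ (Ident C c) x = x"
      by (auto simp: Sec_fibre_product presheaf_def)
  next
    fix f g x assume "f \<in> Arr C" "g \<in> Arr C" "Cod C g = Dom C f" "x \<in> Sec PQ (Cod C f)"
    with P Q show "Res PQ (f \<cdot> g) x = Res PQ g (Res PQ f x)"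
      by (auto simp: Sec_fibre_product presheaf_def)
  qed
qed

text \<open>A matching family of pairs is a pair of matching families, which glue to \<open>a\<close> and \<open>b\<close>.  Both
  \<open>\<theta> a\<close> and \<open>\<phi> b\<close> glue the same family of \<open>R\<close>, so they agree and \<open>(a, b)\<close> lies in the fibre
  product.\<close>

lemma sheaf_fibre_product: "sheaf C J PQ"
  unfolding sheaf_def
proof (intro conjI ballI allI impI presheaf_fibre_product)
  fix c S z
  assume c: "c \<in> Obj C" and S: "S \<in> J c" and z: "matching_family C PQ S z"
  have "sieve C c S" using J c S by (auto simp: grothendieck_topology_def)
  then have SA: "f \<in> Arr C" "Cod C f = c" and SC: "\<And>g. \<lbrakk>g \<in> Arr C; Cod C g = Dom C f\<rbrakk> \<Longrightarrow> f \<cdot> g \<in> S"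
    if "f \<in> S" for f
    using that by (auto simp: sieve_def)
  have glue: "\<exists>!y. y \<in> Sec Y c \<and> (\<forall>f \<in> S. Res Y f y = w f)"
    if "sheaf C J Y" "matching_family C Y S w" for Y :: "('o, 'a, 'u) psh" and w
    using that c S by (auto simp: sheaf_def)
  have sh: "sheaf C J P" "sheaf C J Q" "sheaf C J R" using \<theta> \<phi> by (auto simp: sheaf_arrow_iff)
  define x where "x f = fst (inv e (z f))" for f
  define y where "y f = snd (inv e (z f))" for f
  have xy: "z f = e (x f, y f)" "x f \<in> Sec P (Dom C f)" "y f \<in> Sec Q (Dom C f)"
    "\<theta> (Dom C f) (x f) = \<phi> (Dom C f) (y f)" if "f \<in> S" for f
    using z that by (auto simp: matching_family_def Sec_fibre_product x_def y_def)
  have "Res P g (x f) = x (f \<cdot> g) \<and> Res Q g (y f) = y (f \<cdot> g)"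
    if "f \<in> S" "g \<in> Arr C" "Cod C g = Dom C f" for f g
  proof -
    have "Res PQ g (z f) = z (f \<cdot> g)" using z that by (simp add: matching_family_def)
    then show ?thesis using that SC[of f g] by (simp add: xy)
  qed
  then have x: "matching_family C P S x" and y: "matching_family C Q S y"
    using xy by (auto simp: matching_family_def)
  obtain a where a: "a \<in> Sec P c" "\<And>f. f \<in> S \<Longrightarrow> Res P f a = x f"
    using glue[OF sh(1) x] by blast
  obtain b where b: "b \<in> Sec Q c" "\<And>f. f \<in> S \<Longrightarrow> Res Q f b = y f"
    using glue[OF sh(2) y] by blast
  have \<theta>a: "\<theta> c a \<in> Sec R c" and \<phi>b: "\<phi> c b \<in> Sec R c" using \<theta> \<phi> a b c by (auto simp: sheaf_arrow_iff)
  define w where "w f = \<theta> (Dom C f) (x f)" for f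
  have w\<theta>: "Res R f (\<theta> c a) = w f" and w\<phi>: "Res R f (\<phi> c b) = w f" if "f \<in> S" for f
  proof -
    have "Res R f (\<theta> c a) = \<theta> (Dom C f) (Res P f a)"
      using \<theta> SA[OF that] a(1) unfolding sheaf_arrow_iff by metis
    then show "Res R f (\<theta> c a) = w f" by (simp add: w_def a that)
    have "Res R f (\<phi> c b) = \<phi> (Dom C f) (Res Q f b)"
      using \<phi> SA[OF that] b(1) unfolding sheaf_arrow_iff by metis
    then show "Res R f (\<phi> c b) = w f" by (simp add: w_def b xy that)
  qed
  have "matching_family C R S w" unfolding matching_family_def
  proof (intro conjI ballI impI)
    fix f assume f: "f \<in> S"
    then show "w f \<in> Sec R (Dom C f)"
      using \<theta> xy(2)[OF f] SA[OF f] Dom_in_Obj by (auto simp: w_def sheaf_arrow_iff)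
  next
    fix f g assume f: "f \<in> S" and g: "g \<in> Arr C" "Cod C g = Dom C f"
    then have "Res R g (w f) = \<theta> (Dom C g) (Res P g (x f))"
      using \<theta> xy(2)[OF f] unfolding w_def sheaf_arrow_iff by metis
    also have "\<dots> = w (f \<cdot> g)"
      using x f g SA[OF f] by (simp add: matching_family_def w_def)
    finally show "Res R g (w f) = w (f \<cdot> g)" .
  qed
  from glue[OF sh(3) this] have ab: "\<theta> c a = \<phi> c b" using \<theta>a \<phi>b w\<theta> w\<phi> by blast
  show "\<exists>!v. v \<in> Sec PQ c \<and> (\<forall>f\<in>S. Res PQ f v = z f)"
  proof (rule ex1I[of _ "e (a, b)"])
    show "e (a, b) \<in> Sec PQ c \<and> (\<forall>f\<in>S. Res PQ f (e (a, b)) = z f)"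
      using a b ab by (auto simp: Sec_fibre_product xy)
  next
    fix v assume v: "v \<in> Sec PQ c \<and> (\<forall>f\<in>S. Res PQ f v = z f)"
    then obtain a' b' where v': "v = e (a', b')" and *: "a' \<in> Sec P c" "b' \<in> Sec Q c"
      by (auto simp: Sec_fibre_product)
    with v have "\<forall>f\<in>S. Res P f a' = x f" "\<forall>f\<in>S. Res Q f b' = y f" by (auto simp: xy)
    with * a b have "a' = a" "b' = b" using glue[OF sh(1) x] glue[OF sh(2) y] by blast+
    then show "v = e (a, b)" by (simp add: v')
  qed
qed

lemma fibre_product_is_pullback:
  assumes cat: "category (sheaf_cat C J :: (('o, 'a, 'u) psh, _) cat)"
  shows "\<exists>p q. is_pullback (sheaf_cat C J) (P, \<theta>, R) (Q, \<phi>, R) p q"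
proof -
  interpret S: category "sheaf_cat C J :: (('o, 'a, 'u) psh, _) cat" by (rule cat)
  define \<pi> where "\<pi> = (\<lambda>c \<in> Obj C. \<lambda>z \<in> Sec PQ c. fst (inv e z))"
  define \<rho> where "\<rho> = (\<lambda>c \<in> Obj C. \<lambda>z \<in> Sec PQ c. snd (inv e z))"
  have ResX: "Res PQ f z \<in> Sec PQ (Dom C f)" if "f \<in> Arr C" "z \<in> Sec PQ (Cod C f)" for f z
    using presheaf_fibre_product that by (auto simp: presheaf_def)
  have \<pi>: "(PQ, \<pi>, P) \<in> sheaf_arrows C J" and \<rho>: "(PQ, \<rho>, Q) \<in> sheaf_arrows C J"
    using \<theta> \<phi> ResX by (auto simp: sheaf_arrow_iff sheaf_fibre_product \<pi>_def \<rho>_def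
      Dom_in_Obj Cod_in_Obj Sec_fibre_product)
  have "is_pullback (sheaf_cat C J) (P, \<theta>, R) (Q, \<phi>, R) (PQ, \<pi>, P) (PQ, \<rho>, Q)"
  proof (rule S.pullbackI)
    show "(P, \<theta>, R) \<cdot>\<^bsub>sheaf_cat C J\<^esub> (PQ, \<pi>, P) = (Q, \<phi>, R) \<cdot>\<^bsub>sheaf_cat C J\<^esub> (PQ, \<rho>, Q)"
      by (auto simp: compose_def \<pi>_def \<rho>_def Sec_fibre_product fun_eq_iff restrict_def)
  next
    fix s t
    assume "s \<in> Arr (sheaf_cat C J)" "t \<in> Arr (sheaf_cat C J)"
      "Dom (sheaf_cat C J) s = Dom (sheaf_cat C J) t"
      "Cod (sheaf_cat C J) s = Dom (sheaf_cat C J) (P, \<theta>, R)"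
      "Cod (sheaf_cat C J) t = Dom (sheaf_cat C J) (Q, \<phi>, R)"
      and eq: "(P, \<theta>, R) \<cdot>\<^bsub>sheaf_cat C J\<^esub> s = (Q, \<phi>, R) \<cdot>\<^bsub>sheaf_cat C J\<^esub> t"
    then obtain Y \<sigma> \<tau> where st: "s = (Y, \<sigma>, P)" "t = (Y, \<tau>, Q)"
      and \<sigma>: "(Y, \<sigma>, P) \<in> sheaf_arrows C J" and \<tau>: "(Y, \<tau>, Q) \<in> sheaf_arrows C J"
      by (cases s; cases t) auto
    have st_eq: "\<theta> c (\<sigma> c u) = \<phi> c (\<tau> c u)" if "c \<in> Obj C" "u \<in> Sec Y c" for c u
    proof -
      have "(\<lambda>c \<in> Obj C. compose (Sec Y c) (\<theta> c) (\<sigma> c)) = (\<lambda>c \<in> Obj C. compose (Sec Y c) (\<phi> c) (\<tau> c))"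
        using eq by (simp add: st)
      from fun_cong[OF fun_cong[OF this, of c], of u] that show ?thesis by (simp add: compose_def)
    qed
    have ResY: "Res Y f u \<in> Sec Y (Dom C f)" if "f \<in> Arr C" "u \<in> Sec Y (Cod C f)" for f u
      using \<sigma> that by (auto simp: sheaf_arrow_iff sheaf_def presheaf_def)
    define \<kappa> where "\<kappa> = (\<lambda>c \<in> Obj C. \<lambda>u \<in> Sec Y c. e (\<sigma> c u, \<tau> c u))"
    have \<kappa>: "(Y, \<kappa>, PQ) \<in> sheaf_arrows C J"
      using \<sigma> \<tau> ResY by (auto simp: sheaf_arrow_iff sheaf_fibre_product \<kappa>_def Dom_in_Obj Cod_in_Obj
        Sec_fibre_product st_eq)
    have pair_mem: "e (\<sigma> c u, \<tau> c u) \<in> Sec PQ c" if "c \<in> Obj C" "u \<in> Sec Y c" for c u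
      using \<sigma> \<tau> that by (auto simp: Sec_fibre_product st_eq sheaf_arrow_iff)
    have "(PQ, \<pi>, P) \<cdot>\<^bsub>sheaf_cat C J\<^esub> (Y, \<kappa>, PQ) \<in> Arr (sheaf_cat C J)"
      "(PQ, \<rho>, Q) \<cdot>\<^bsub>sheaf_cat C J\<^esub> (Y, \<kappa>, PQ) \<in> Arr (sheaf_cat C J)"
      by (rule S.Arr_Comp; simp add: \<pi> \<rho> \<kappa>)+
    then have "(PQ, \<pi>, P) \<cdot>\<^bsub>sheaf_cat C J\<^esub> (Y, \<kappa>, PQ) = s" "(PQ, \<rho>, Q) \<cdot>\<^bsub>sheaf_cat C J\<^esub> (Y, \<kappa>, PQ) = t"
      unfolding st using \<sigma> \<tau>
      by (auto simp: compose_def \<pi>_def \<rho>_def \<kappa>_def pair_mem intro!: sheaf_arrow_eqI)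
    then show "\<exists>k\<in>Arr (sheaf_cat C J). Dom (sheaf_cat C J) k = Dom (sheaf_cat C J) t \<and>
        Cod (sheaf_cat C J) k = Dom (sheaf_cat C J) (PQ, \<pi>, P) \<and>
        (PQ, \<pi>, P) \<cdot>\<^bsub>sheaf_cat C J\<^esub> k = s \<and> (PQ, \<rho>, Q) \<cdot>\<^bsub>sheaf_cat C J\<^esub> k = t"
      by (intro bexI[of _ "(Y, \<kappa>, PQ)"]) (simp_all add: \<kappa> st)
  next
    fix k l
    assume "k \<in> Arr (sheaf_cat C J)" "l \<in> Arr (sheaf_cat C J)"
      "Dom (sheaf_cat C J) k = Dom (sheaf_cat C J) l"
      "Cod (sheaf_cat C J) k = Dom (sheaf_cat C J) (PQ, \<pi>, P)"
      "Cod (sheaf_cat C J) l = Dom (sheaf_cat C J) (PQ, \<pi>, P)"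
      and eq: "(PQ, \<pi>, P) \<cdot>\<^bsub>sheaf_cat C J\<^esub> k = (PQ, \<pi>, P) \<cdot>\<^bsub>sheaf_cat C J\<^esub> l"
        "(PQ, \<rho>, Q) \<cdot>\<^bsub>sheaf_cat C J\<^esub> k = (PQ, \<rho>, Q) \<cdot>\<^bsub>sheaf_cat C J\<^esub> l"
    then obtain Y \<kappa> \<mu> where kl: "k = (Y, \<kappa>, PQ)" "l = (Y, \<mu>, PQ)"
      and \<kappa>: "(Y, \<kappa>, PQ) \<in> sheaf_arrows C J" and \<mu>: "(Y, \<mu>, PQ) \<in> sheaf_arrows C J"
      by (cases k; cases l) auto
    have "\<kappa> = \<mu>"
    proof (rule sheaf_arrow_eqI[OF \<kappa> \<mu>])
      fix c u assume cu: "c \<in> Obj C" "u \<in> Sec Y c"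
      have "(\<lambda>c \<in> Obj C. compose (Sec Y c) (\<pi> c) (\<kappa> c)) = (\<lambda>c \<in> Obj C. compose (Sec Y c) (\<pi> c) (\<mu> c))"
        "(\<lambda>c \<in> Obj C. compose (Sec Y c) (\<rho> c) (\<kappa> c)) = (\<lambda>c \<in> Obj C. compose (Sec Y c) (\<rho> c) (\<mu> c))"
        using eq by (simp_all add: kl)
      from fun_cong[OF fun_cong[OF this(1), of c], of u] fun_cong[OF fun_cong[OF this(2), of c], of u] cu
      have "\<pi> c (\<kappa> c u) = \<pi> c (\<mu> c u)" "\<rho> c (\<kappa> c u) = \<rho> c (\<mu> c u)" by (simp_all add: compose_def)
      moreover have "\<kappa> c u \<in> Sec PQ c" "\<mu> c u \<in> Sec PQ c" using \<kappa> \<mu> cu by (auto simp: sheaf_arrow_iff)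
      ultimately show "\<kappa> c u = \<mu> c u" using cu by (auto simp: \<pi>_def \<rho>_def Sec_fibre_product)
    qed
    then show "k = l" by (simp add: kl)
  qed (simp_all add: \<theta> \<phi> \<pi> \<rho>)
  then show ?thesis by blast
qed

end

lemma sheaf_cat_has_pullbacks:
  assumes "grothendieck_topology C J"
    and "category (sheaf_cat C J :: (('o, 'a, 'u::universe) psh, _) cat)"
  shows "has_pullbacks (sheaf_cat C J :: (('o, 'a, 'u) psh, _) cat)"
proof -
  obtain e :: "'u \<times> 'u \<Rightarrow> 'u" where "inj e" using pairing_exists by blast
  with fibre_product_is_pullback[OF assms(1) _ _ _ assms(2)] show ?thesis
    by (fastforce simp: has_pullbacks_def)
qed

end

lemma topos_has_pullbacks:
  assumes "grothendieck_topos TYPE('u::universe) E"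
  shows "has_pullbacks E"
proof -
  obtain C :: "('u, 'u) cat" and J where C: "category C" "grothendieck_topology C J"
    and eq: "equivalent_cats E (sheaf_cat C J :: (('u, 'u, 'u) psh, _) cat)"
    using assms unfolding grothendieck_topos_def by blast
  then have "category (sheaf_cat C J :: (('u, 'u, 'u) psh, _) cat)"
    by (auto simp: equivalent_cats_def is_functor_def)
  with C eq show ?thesis by (blast intro: has_pullbacks_equivalent category.sheaf_cat_has_pullbacks)
qed

theorem proposition5p2p8:
  fixes F :: "('p, 'b) cat" and E :: "('o, 'a) cat"
    and f :: "('p, 'b, 'o, 'a) ess_geom_mor"
  assumes "grothendieck_topos TYPE('u::universe) F"
    and "grothendieck_topos TYPE('u) E"
    and "essential_geometric_morphism F E f"
  shows "locally_connected F E f \<longleftrightarrow> street_fibration F E (essential_image f)"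
proof -
  have adj: "adjunction F E (essential_image f) (inverse_image f) (ess_unit f) (ess_counit f)"
    using assms(3) by (simp add: essential_geometric_morphism_def)
  then interpret essential_image_adjunction F E f
    by (auto simp: essential_image_adjunction_def adjoint_functors_def adjoint_functors_axioms_def
      adjunction_def is_functor_def)
  show ?thesis
    by (rule locally_connected_iff_fibration) (rule topos_has_pullbacks, fact)+
qed

end
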